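(* Let $(\mathcal U,\mathcal V)$ be a hereditary cotorsion pair in $\mathcal B$, let $\mathcal W=\mathcal U\cap\mathcal V$, and let $i\ge 1$ be an integer. Put $\mathcal W_0=\mathcal W$, $\mathcal W_1=\mathrm{Cone}(\mathcal W,\mathcal W)$ and $\mathcal W_{j+1}=\mathrm{Cone}(\mathcal W_j,\mathcal W)$. Assume that $({}^{\bot_1}(\Sigma\mathcal V),\Sigma\mathcal V)$ and $({}^{\bot_1}(\Sigma^i\mathcal V),\Sigma^i\mathcal V)$ are also cotorsion pairs in $\mathcal B$. Then there exists a one-to-one correspondence from the first of the following sets to the second: (a) cotorsion pairs $(\mathcal U',\mathcal V')$ in $\mathcal B$ such that $\mathcal U\subseteq\mathcal U'\subseteq{}^{\bot_1}(\Sigma^i\mathcal V)$; (b) cotorsion pairs $(\mathcal X,\mathcal Y)$ in $\mathcal W_i$.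
   Context: Ambient category: $k$ is a field and $(\mathcal B,\mathbb E,\mathfrak s)$ is a Krull-Schmidt, Hom-finite, $k$-linear extriangulated category (in the sense of Nakaoka-Palu) with enough projectives and enough injectives, satisfying condition (WIC): if a composite $A\xrightarrow{f}B\xrightarrow{g}C$ is a deflation then $g$ is a deflation, and if it is an inflation then $f$ is an inflation. $\mathcal P$ and $\mathcal I$ denote the subcategories of projective and of injective objects of $\mathcal B$. All subcategories are full and closed under isomorphisms. $\mathbb E$-triangles are written $A\to B\to C\dashrightarrow$. For subcategories $\mathcal B',\mathcal B''$: $\mathrm{Cone}(\mathcal B',\mathcal B'')$ is the subcategory of all $X$ admitting an $\mathbb E$-triangle $B'\to B''\to X\dashrightarrow$, and $\mathrm{CoCone}(\mathcal B',\mathcal B'')$ of all $X$ admitting an $\mathbb E$-triangle $X\to B'\to B''\dashrightarrow$, with $B'\in\mathcal B'$, $B''\in\mathcal B''$. $\Sigma\mathcal B'=\mathrm{Cone}(\mathcal B',\mathcal I)$, $\Sigma^{i+1}\mathcal B'=\mathrm{Cone}(\Sigma^{i}\mathcal B',\mathcal I)$, $\Omega\mathcal B'=\mathrm{CoCone}(\mathcal P,\mathcal B')$. ${}^{\bot_1}\mathcal B'=\{M\in\mathcal B\mid \mathbb E(M,\mathcal B')=0\}$. A cotorsion pair in an extriangulated category $\mathcal C$ is a pair $(\mathcal X,\mathcal Y)$ of subcategories of $\mathcal C$ closed under direct summands such that $\mathbb E(\mathcal X,\mathcal Y)=0$ and every $C\in\mathcal C$ admits $\mathbb E$-triangles $Y_C\to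 X_C\to C\dashrightarrow$ and $C\to Y^C\to X^C\dashrightarrow$ in $\mathcal C$ with $X_C,X^C\in\mathcal X$ and $Y_C,Y^C\in\mathcal Y$. A cotorsion pair $(\mathcal U,\mathcal V)$ in $\mathcal B$ is hereditary if $\Omega\mathcal U\subseteq\mathcal U$. The subcategory $\mathcal W_i$ is closed under extensions in $\mathcal B$ and is regarded as an extriangulated category with the $\mathbb E$-triangles of $\mathcal B$ whose terms all lie in $\mathcal W_i$. *)

theory Defs
  imports "HOL-Algebra.Module"
begin

section \<open>Linear categories with an extension bifunctor\<close>

text \<open>
  The data of a \<open>k\<close>-linear extriangulated category. \<open>Hom C A B\<close> is the \<open>k\<close>-module of morphisms
  \<open>A \<rightarrow> B\<close> and \<open>Ext C X A\<close> is the \<open>k\<close>-module \<open>\<bbbE>(X, A)\<close>, contravariant in the first object and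
  covariant in the second. (Of a module record only the additive structure and \<open>smult\<close> are used.)
  For \<open>a : A \<rightarrow> A'\<close> and \<open>c : X' \<rightarrow> X\<close>, \<open>push C a\<close> is \<open>a\<^sub>* : \<bbbE>(X, A) \<rightarrow> \<bbbE>(X, A')\<close> and
  \<open>pull C c\<close> is \<open>c\<^sup>* : \<bbbE>(X, A) \<rightarrow> \<bbbE>(X', A)\<close>. The realization \<open>\<s>\<close> is \<open>rlz\<close>: for \<open>\<delta> \<in> \<bbbE>(X, A)\<close>,
  \<open>rlz C X A \<delta>\<close> is an equivalence class of sequences \<open>A \<rightarrow> B \<rightarrow> X\<close>, given as triples \<open>(B, x, y)\<close>.

  Hom-sets need not be disjoint, so every notion below names the end objects it refers to.
\<close>

record ('k, 'o, 'm, 'e) ext_cat =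
  obj :: "'o set"
  Hom :: "'o \<Rightarrow> 'o \<Rightarrow> ('k, 'm) module"
  ident :: "'o \<Rightarrow> 'm"
  cmp :: "'m \<Rightarrow> 'm \<Rightarrow> 'm" (infixl "\<cdot>\<index>" 70)
  Ext :: "'o \<Rightarrow> 'o \<Rightarrow> ('k, 'e) module"
  push :: "'m \<Rightarrow> 'e \<Rightarrow> 'e"
  pull :: "'m \<Rightarrow> 'e \<Rightarrow> 'e"
  rlz :: "'o \<Rightarrow> 'o \<Rightarrow> 'e \<Rightarrow> ('o \<times> 'm \<times> 'm) set"

abbreviation arr :: "('k, 'o, 'm, 'e, 'z) ext_cat_scheme \<Rightarrow> 'o \<Rightarrow> 'o \<Rightarrow> 'm set" where
  "arr C A B \<equiv> carrier (Hom C A B)"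

abbreviation ext :: "('k, 'o, 'm, 'e, 'z) ext_cat_scheme \<Rightarrow> 'o \<Rightarrow> 'o \<Rightarrow> 'e set" where
  "ext C X A \<equiv> carrier (Ext C X A)"

definition linear_map ::
  "('k, 'r) ring_scheme \<Rightarrow> ('k, 'a, 'p) module_scheme \<Rightarrow> ('k, 'b, 'q) module_scheme \<Rightarrow> ('a \<Rightarrow> 'b) \<Rightarrow> bool"
  where "linear_map K M N f \<longleftrightarrow>
    f \<in> carrier M \<rightarrow> carrier N \<and>
    (\<forall>u\<in>carrier M. \<forall>v\<in>carrier M. f (u \<oplus>\<^bsub>M\<^esub> v) = f u \<oplus>\<^bsub>N\<^esub> f v) \<and>
    (\<forall>r\<in>carrier K. \<forall>u\<in>carrier M. f (r \<odot>\<^bsub>M\<^esub> u) = r \<odot>\<^bsub>N\<^esub> f u)"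

definition finite_dimensional :: "('k, 'r) ring_scheme \<Rightarrow> ('k, 'a, 'p) module_scheme \<Rightarrow> bool" where
  "finite_dimensional K M \<longleftrightarrow>
    (\<exists>S. finite S \<and> S \<subseteq> carrier M \<and>
      (\<forall>v\<in>carrier M. \<exists>c. c \<in> S \<rightarrow> carrier K \<and> v = (\<Oplus>\<^bsub>M\<^esub>u\<in>S. c u \<odot>\<^bsub>M\<^esub> u)))"

definition is_iso :: "('k, 'o, 'm, 'e, 'z) ext_cat_scheme \<Rightarrow> 'o \<Rightarrow> 'o \<Rightarrow> 'm \<Rightarrow> bool" where
  "is_iso C A B f \<longleftrightarrow> f \<in> arr C A B \<and>
    (\<exists>g\<in>arr C B A. g \<cdot>\<^bsub>C\<^esub> f = ident C A \<and> f \<cdot>\<^bsub>C\<^esub> g = ident C B)"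

definition zero_object :: "('k, 'o, 'm, 'e, 'z) ext_cat_scheme \<Rightarrow> 'o \<Rightarrow> bool" where
  "zero_object C Z \<longleftrightarrow> Z \<in> obj C \<and>
    (\<forall>A\<in>obj C. arr C Z A = {\<zero>\<^bsub>Hom C Z A\<^esub>} \<and> arr C A Z = {\<zero>\<^bsub>Hom C A Z\<^esub>})"

definition biproduct ::
  "('k, 'o, 'm, 'e, 'z) ext_cat_scheme \<Rightarrow> 'o \<Rightarrow> 'o \<Rightarrow> 'o \<Rightarrow> 'm \<Rightarrow> 'm \<Rightarrow> 'm \<Rightarrow> 'm \<Rightarrow> bool" where
  "biproduct C A A' S i i' p p' \<longleftrightarrow>
    A \<in> obj C \<and> A' \<in> obj C \<and> S \<in> obj C \<and>
    i \<in> arr C A S \<and> i' \<in> arr C A' S \<and> p \<in> arr C S A \<and> p' \<in> arr C S A' \<and>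
    p \<cdot>\<^bsub>C\<^esub> i = ident C A \<and> p' \<cdot>\<^bsub>C\<^esub> i' = ident C A' \<and>
    p \<cdot>\<^bsub>C\<^esub> i' = \<zero>\<^bsub>Hom C A' A\<^esub> \<and> p' \<cdot>\<^bsub>C\<^esub> i = \<zero>\<^bsub>Hom C A A'\<^esub> \<and>
    (i \<cdot>\<^bsub>C\<^esub> p) \<oplus>\<^bsub>Hom C S S\<^esub> (i' \<cdot>\<^bsub>C\<^esub> p') = ident C S"

locale linear_category = field K for K :: "('k, 'r) ring_scheme" (structure) +
  fixes C :: "('k, 'o, 'm, 'e, 'z) ext_cat_scheme"
  assumes Hom_module: "\<lbrakk>A \<in> obj C; B \<in> obj C\<rbrakk> \<Longrightarrow> module K (Hom C A B)"
    and ident_arr: "A \<in> obj C \<Longrightarrow> ident C A \<in> arr C A A"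
    and cmp_linear_left:
      "\<lbrakk>A \<in> obj C; B \<in> obj C; D \<in> obj C; f \<in> arr C A B\<rbrakk>
        \<Longrightarrow> linear_map K (Hom C B D) (Hom C A D) (\<lambda>g. g \<cdot>\<^bsub>C\<^esub> f)"
    and cmp_linear_right:
      "\<lbrakk>A \<in> obj C; B \<in> obj C; D \<in> obj C; g \<in> arr C B D\<rbrakk>
        \<Longrightarrow> linear_map K (Hom C A B) (Hom C A D) (\<lambda>f. g \<cdot>\<^bsub>C\<^esub> f)"
    and cmp_ident_left: "\<lbrakk>A \<in> obj C; B \<in> obj C; f \<in> arr C A B\<rbrakk> \<Longrightarrow> ident C B \<cdot>\<^bsub>C\<^esub> f = f"
    and cmp_ident_right: "\<lbrakk>A \<in> obj C; B \<in> obj C; f \<in> arr C A B\<rbrakk> \<Longrightarrow> f \<cdot>\<^bsub>C\<^esub> ident C A = f"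
    and cmp_assoc:
      "\<lbrakk>A \<in> obj C; B \<in> obj C; D \<in> obj C; E \<in> obj C;
        f \<in> arr C A B; g \<in> arr C B D; h \<in> arr C D E\<rbrakk>
        \<Longrightarrow> (h \<cdot>\<^bsub>C\<^esub> g) \<cdot>\<^bsub>C\<^esub> f = h \<cdot>\<^bsub>C\<^esub> (g \<cdot>\<^bsub>C\<^esub> f)"
    and has_zero_object: "\<exists>Z. zero_object C Z"
    and has_biproducts:
      "\<lbrakk>A \<in> obj C; A' \<in> obj C\<rbrakk> \<Longrightarrow> \<exists>S i i' p p'. biproduct C A A' S i i' p p'"

section \<open>Sequences and \<open>\<bbbE>\<close>-triangles\<close>

definition sequences :: "('k, 'o, 'm, 'e, 'z) ext_cat_scheme \<Rightarrow> 'o \<Rightarrow> 'o \<Rightarrow> ('o \<times> 'm \<times> 'm) set" where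
  "sequences C X A = {(B, x, y). B \<in> obj C \<and> x \<in> arr C A B \<and> y \<in> arr C B X}"

definition seq_equiv ::
  "('k, 'o, 'm, 'e, 'z) ext_cat_scheme \<Rightarrow> 'o \<Rightarrow> 'o \<Rightarrow> (('o \<times> 'm \<times> 'm) \<times> ('o \<times> 'm \<times> 'm)) set" where
  "seq_equiv C X A = {((B, x, y), (B', x', y')).
     (B, x, y) \<in> sequences C X A \<and> (B', x', y') \<in> sequences C X A \<and>
     (\<exists>b. is_iso C B B' b \<and> b \<cdot>\<^bsub>C\<^esub> x = x' \<and> y' \<cdot>\<^bsub>C\<^esub> b = y)}"

text \<open>\<open>etriangle C A x B y X \<delta>\<close>: the sequence \<open>A \<rightarrow> B \<rightarrow> X\<close> with morphisms \<open>x\<close>, \<open>y\<close> realizes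
  \<open>\<delta> \<in> \<bbbE>(X, A)\<close>.\<close>

definition etriangle ::
  "('k, 'o, 'm, 'e, 'z) ext_cat_scheme \<Rightarrow> 'o \<Rightarrow> 'm \<Rightarrow> 'o \<Rightarrow> 'm \<Rightarrow> 'o \<Rightarrow> 'e \<Rightarrow> bool" where
  "etriangle C A x B y X \<delta> \<longleftrightarrow>
     A \<in> obj C \<and> B \<in> obj C \<and> X \<in> obj C \<and> x \<in> arr C A B \<and> y \<in> arr C B X \<and>
     \<delta> \<in> ext C X A \<and> (B, x, y) \<in> rlz C X A \<delta>"

definition conflation :: "('k, 'o, 'm, 'e, 'z) ext_cat_scheme \<Rightarrow> 'o \<Rightarrow> 'm \<Rightarrow> 'o \<Rightarrow> 'm \<Rightarrow> 'o \<Rightarrow> bool" where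
  "conflation C A x B y X \<longleftrightarrow> (\<exists>\<delta>. etriangle C A x B y X \<delta>)"

definition inflation :: "('k, 'o, 'm, 'e, 'z) ext_cat_scheme \<Rightarrow> 'o \<Rightarrow> 'o \<Rightarrow> 'm \<Rightarrow> bool" where
  "inflation C A B x \<longleftrightarrow> (\<exists>y X. conflation C A x B y X)"

definition deflation :: "('k, 'o, 'm, 'e, 'z) ext_cat_scheme \<Rightarrow> 'o \<Rightarrow> 'o \<Rightarrow> 'm \<Rightarrow> bool" where
  "deflation C B X y \<longleftrightarrow> (\<exists>x A. conflation C A x B y X)"

section \<open>Extriangulated categories\<close>

text \<open>The axioms of Nakaoka and Palu, with the bifunctor \<open>\<bbbE>\<close> required to be \<open>k\<close>-bilinear.\<close>

locale extriangulated_category = linear_category K C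
  for K :: "('k, 'r) ring_scheme" (structure)
    and C :: "('k, 'o, 'm, 'e, 'z) ext_cat_scheme" +
  \<comment> \<open>(ET1)\<close>
  assumes Ext_module: "\<lbrakk>X \<in> obj C; A \<in> obj C\<rbrakk> \<Longrightarrow> module K (Ext C X A)"
    and push_linear:
      "\<lbrakk>X \<in> obj C; A \<in> obj C; A' \<in> obj C; a \<in> arr C A A'\<rbrakk>
        \<Longrightarrow> linear_map K (Ext C X A) (Ext C X A') (push C a)"
    and push_linear_arr:
      "\<lbrakk>X \<in> obj C; A \<in> obj C; A' \<in> obj C; \<delta> \<in> ext C X A\<rbrakk>
        \<Longrightarrow> linear_map K (Hom C A A') (Ext C X A') (\<lambda>a. push C a \<delta>)"
    and push_ident: "\<lbrakk>X \<in> obj C; A \<in> obj C; \<delta> \<in> ext C X A\<rbrakk> \<Longrightarrow> push C (ident C A) \<delta> = \<delta>"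
    and push_cmp:
      "\<lbrakk>X \<in> obj C; A \<in> obj C; A' \<in> obj C; A'' \<in> obj C;
        a \<in> arr C A A'; a' \<in> arr C A' A''; \<delta> \<in> ext C X A\<rbrakk>
        \<Longrightarrow> push C (a' \<cdot>\<^bsub>C\<^esub> a) \<delta> = push C a' (push C a \<delta>)"
    and pull_linear:
      "\<lbrakk>X \<in> obj C; X' \<in> obj C; A \<in> obj C; c \<in> arr C X' X\<rbrakk>
        \<Longrightarrow> linear_map K (Ext C X A) (Ext C X' A) (pull C c)"
    and pull_linear_arr:
      "\<lbrakk>X \<in> obj C; X' \<in> obj C; A \<in> obj C; \<delta> \<in> ext C X A\<rbrakk>
        \<Longrightarrow> linear_map K (Hom C X' X) (Ext C X' A) (\<lambda>c. pull C c \<delta>)"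
    and pull_ident: "\<lbrakk>X \<in> obj C; A \<in> obj C; \<delta> \<in> ext C X A\<rbrakk> \<Longrightarrow> pull C (ident C X) \<delta> = \<delta>"
    and pull_cmp:
      "\<lbrakk>X \<in> obj C; X' \<in> obj C; X'' \<in> obj C; A \<in> obj C;
        c \<in> arr C X' X; c' \<in> arr C X'' X'; \<delta> \<in> ext C X A\<rbrakk>
        \<Longrightarrow> pull C (c \<cdot>\<^bsub>C\<^esub> c') \<delta> = pull C c' (pull C c \<delta>)"
    and push_pull:
      "\<lbrakk>X \<in> obj C; X' \<in> obj C; A \<in> obj C; A' \<in> obj C;
        a \<in> arr C A A'; c \<in> arr C X' X; \<delta> \<in> ext C X A\<rbrakk>
        \<Longrightarrow> push C a (pull C c \<delta>) = pull C c (push C a \<delta>)"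
  \<comment> \<open>(ET2): \<open>rlz\<close> is an additive realization. In \<open>rlz_dsum\<close> the extension in the conclusion is
    \<open>\<delta> \<oplus> \<delta>'\<close>, i.e. the element of \<open>\<bbbE>(X \<oplus> X', A \<oplus> A')\<close> with components \<open>(\<delta>, 0, 0, \<delta>')\<close>.\<close>
    and rlz_class:
      "\<lbrakk>X \<in> obj C; A \<in> obj C; \<delta> \<in> ext C X A\<rbrakk>
        \<Longrightarrow> rlz C X A \<delta> \<in> sequences C X A // seq_equiv C X A"
    and rlz_morphism:
      "\<lbrakk>etriangle C A x B y X \<delta>; etriangle C A' x' B' y' X' \<delta>';
        a \<in> arr C A A'; c \<in> arr C X X'; push C a \<delta> = pull C c \<delta>'\<rbrakk>
        \<Longrightarrow> \<exists>b\<in>arr C B B'. b \<cdot>\<^bsub>C\<^esub> x = x' \<cdot>\<^bsub>C\<^esub> a \<and> y' \<cdot>\<^bsub>C\<^esub> b = c \<cdot>\<^bsub>C\<^esub> y"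
    and rlz_zero:
      "biproduct C A X S i i' p p' \<Longrightarrow> (S, i, p') \<in> rlz C X A \<zero>\<^bsub>Ext C X A\<^esub>"
    and rlz_dsum:
      "\<lbrakk>etriangle C A x B y X \<delta>; etriangle C A' x' B' y' X' \<delta>';
        biproduct C A A' SA i i' p p'; biproduct C B B' SB j j' q q';
        biproduct C X X' SX l l' r r'\<rbrakk>
        \<Longrightarrow> (SB,
             (j \<cdot>\<^bsub>C\<^esub> x \<cdot>\<^bsub>C\<^esub> p) \<oplus>\<^bsub>Hom C SA SB\<^esub> (j' \<cdot>\<^bsub>C\<^esub> x' \<cdot>\<^bsub>C\<^esub> p'),
             (l \<cdot>\<^bsub>C\<^esub> y \<cdot>\<^bsub>C\<^esub> q) \<oplus>\<^bsub>Hom C SB SX\<^esub> (l' \<cdot>\<^bsub>C\<^esub> y' \<cdot>\<^bsub>C\<^esub> q'))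
          \<in> rlz C SX SA (push C i (pull C r \<delta>) \<oplus>\<^bsub>Ext C SX SA\<^esub> push C i' (pull C r' \<delta>'))"
  \<comment> \<open>(ET3) and its dual\<close>
    and et3:
      "\<lbrakk>etriangle C A x B y X \<delta>; etriangle C A' x' B' y' X' \<delta>';
        a \<in> arr C A A'; b \<in> arr C B B'; b \<cdot>\<^bsub>C\<^esub> x = x' \<cdot>\<^bsub>C\<^esub> a\<rbrakk>
        \<Longrightarrow> \<exists>c\<in>arr C X X'. push C a \<delta> = pull C c \<delta>' \<and> c \<cdot>\<^bsub>C\<^esub> y = y' \<cdot>\<^bsub>C\<^esub> b"
    and et3_op:
      "\<lbrakk>etriangle C A x B y X \<delta>; etriangle C A' x' B' y' X' \<delta>';
        b \<in> arr C B B'; c \<in> arr C X X'; c \<cdot>\<^bsub>C\<^esub> y = y' \<cdot>\<^bsub>C\<^esub> b\<rbrakk>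
        \<Longrightarrow> \<exists>a\<in>arr C A A'. push C a \<delta> = pull C c \<delta>' \<and> b \<cdot>\<^bsub>C\<^esub> x = x' \<cdot>\<^bsub>C\<^esub> a"
  \<comment> \<open>(ET4) and its dual\<close>
    and et4:
      "\<lbrakk>etriangle C A f B f' D \<delta>; etriangle C B g G g' F \<delta>'\<rbrakk>
        \<Longrightarrow> \<exists>E h' d e \<delta>''.
              etriangle C A (g \<cdot>\<^bsub>C\<^esub> f) G h' E \<delta>'' \<and>
              d \<in> arr C D E \<and> e \<in> arr C E F \<and>
              h' \<cdot>\<^bsub>C\<^esub> g = d \<cdot>\<^bsub>C\<^esub> f' \<and> e \<cdot>\<^bsub>C\<^esub> h' = g' \<and>
              etriangle C D d E e F (push C f' \<delta>') \<and>
              pull C d \<delta>'' = \<delta> \<and>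
              push C f \<delta>'' = pull C e \<delta>'"
    and et4_op:
      "\<lbrakk>etriangle C D f' A f B \<delta>; etriangle C F g' B g G \<delta>'\<rbrakk>
        \<Longrightarrow> \<exists>E h' d e \<delta>''.
              etriangle C E h' A (g \<cdot>\<^bsub>C\<^esub> f) G \<delta>'' \<and>
              d \<in> arr C D E \<and> e \<in> arr C E F \<and>
              h' \<cdot>\<^bsub>C\<^esub> d = f' \<and> f \<cdot>\<^bsub>C\<^esub> h' = g' \<cdot>\<^bsub>C\<^esub> e \<and>
              etriangle C D d E e F (pull C g' \<delta>) \<and>
              push C e \<delta>'' = \<delta>' \<and>
              push C d \<delta> = pull C g \<delta>''"

section \<open>The standing assumptions\<close>

definition projective :: "('k, 'o, 'm, 'e, 'z) ext_cat_scheme \<Rightarrow> 'o \<Rightarrow> bool" where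
  "projective C P \<longleftrightarrow> P \<in> obj C \<and>
    (\<forall>A x B y X c. conflation C A x B y X \<longrightarrow> c \<in> arr C P X \<longrightarrow>
      (\<exists>b\<in>arr C P B. y \<cdot>\<^bsub>C\<^esub> b = c))"

definition injective :: "('k, 'o, 'm, 'e, 'z) ext_cat_scheme \<Rightarrow> 'o \<Rightarrow> bool" where
  "injective C I \<longleftrightarrow> I \<in> obj C \<and>
    (\<forall>A x B y X a. conflation C A x B y X \<longrightarrow> a \<in> arr C A I \<longrightarrow>
      (\<exists>b\<in>arr C B I. b \<cdot>\<^bsub>C\<^esub> x = a))"

abbreviation projectives :: "('k, 'o, 'm, 'e, 'z) ext_cat_scheme \<Rightarrow> 'o set" where
  "projectives C \<equiv> {P. projective C P}"

abbreviation injectives :: "('k, 'o, 'm, 'e, 'z) ext_cat_scheme \<Rightarrow> 'o set" where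
  "injectives C \<equiv> {I. injective C I}"

definition enough_projectives :: "('k, 'o, 'm, 'e, 'z) ext_cat_scheme \<Rightarrow> bool" where
  "enough_projectives C \<longleftrightarrow>
    (\<forall>X\<in>obj C. \<exists>A x P y. projective C P \<and> conflation C A x P y X)"

definition enough_injectives :: "('k, 'o, 'm, 'e, 'z) ext_cat_scheme \<Rightarrow> bool" where
  "enough_injectives C \<longleftrightarrow>
    (\<forall>A\<in>obj C. \<exists>x I y X. injective C I \<and> conflation C A x I y X)"

definition local_endomorphism_ring :: "('k, 'o, 'm, 'e, 'z) ext_cat_scheme \<Rightarrow> 'o \<Rightarrow> bool" where
  "local_endomorphism_ring C X \<longleftrightarrow>
    ident C X \<noteq> \<zero>\<^bsub>Hom C X X\<^esub> \<and>
    (\<forall>f\<in>arr C X X. \<forall>g\<in>arr C X X.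
      \<not> is_iso C X X f \<longrightarrow> \<not> is_iso C X X g \<longrightarrow> \<not> is_iso C X X (f \<oplus>\<^bsub>Hom C X X\<^esub> g))"

text \<open>The empty direct sum, \<open>n = 0\<close>, is the zero object.\<close>

definition finite_direct_sum ::
  "('k, 'o, 'm, 'e, 'z) ext_cat_scheme \<Rightarrow> nat \<Rightarrow> (nat \<Rightarrow> 'o) \<Rightarrow> 'o \<Rightarrow> bool" where
  "finite_direct_sum C n X S \<longleftrightarrow> S \<in> obj C \<and> (\<forall>j<n. X j \<in> obj C) \<and>
    (\<exists>i p. (\<forall>j<n. i j \<in> arr C (X j) S \<and> p j \<in> arr C S (X j)) \<and>
      (\<forall>j<n. \<forall>l<n. p l \<cdot>\<^bsub>C\<^esub> i j = (if l = j then ident C (X j) else \<zero>\<^bsub>Hom C (X j) (X l)\<^esub>)) \<and>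
      (\<Oplus>\<^bsub>Hom C S S\<^esub>j\<in>{..<n}. i j \<cdot>\<^bsub>C\<^esub> p j) = ident C S)"

definition krull_schmidt :: "('k, 'o, 'm, 'e, 'z) ext_cat_scheme \<Rightarrow> bool" where
  "krull_schmidt C \<longleftrightarrow>
    (\<forall>S\<in>obj C. \<exists>n X. finite_direct_sum C n X S \<and> (\<forall>j<n. local_endomorphism_ring C (X j)))"

definition hom_finite :: "('k, 'r) ring_scheme \<Rightarrow> ('k, 'o, 'm, 'e, 'z) ext_cat_scheme \<Rightarrow> bool" where
  "hom_finite K C \<longleftrightarrow> (\<forall>A\<in>obj C. \<forall>B\<in>obj C. finite_dimensional K (Hom C A B))"

definition condition_WIC :: "('k, 'o, 'm, 'e, 'z) ext_cat_scheme \<Rightarrow> bool" where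
  "condition_WIC C \<longleftrightarrow>
    (\<forall>A\<in>obj C. \<forall>B\<in>obj C. \<forall>D\<in>obj C. \<forall>f\<in>arr C A B. \<forall>g\<in>arr C B D.
      (deflation C A D (g \<cdot>\<^bsub>C\<^esub> f) \<longrightarrow> deflation C B D g) \<and>
      (inflation C A D (g \<cdot>\<^bsub>C\<^esub> f) \<longrightarrow> inflation C A B f))"

section \<open>Subcategories and cotorsion pairs\<close>

text \<open>Full subcategories closed under isomorphisms are represented by their sets of objects.\<close>

definition subcategory :: "('k, 'o, 'm, 'e, 'z) ext_cat_scheme \<Rightarrow> 'o set \<Rightarrow> bool" where
  "subcategory C S \<longleftrightarrow> S \<subseteq> obj C \<and>
    (\<forall>A\<in>S. \<forall>B\<in>obj C. \<forall>f. is_iso C A B f \<longrightarrow> B \<in> S)"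

definition closed_under_summands :: "('k, 'o, 'm, 'e, 'z) ext_cat_scheme \<Rightarrow> 'o set \<Rightarrow> bool" where
  "closed_under_summands C S \<longleftrightarrow>
    (\<forall>Z\<in>S. \<forall>A A' i i' p p'. biproduct C A A' Z i i' p p' \<longrightarrow> A \<in> S)"

definition Cone :: "('k, 'o, 'm, 'e, 'z) ext_cat_scheme \<Rightarrow> 'o set \<Rightarrow> 'o set \<Rightarrow> 'o set" where
  "Cone C S T = {X. \<exists>A\<in>S. \<exists>B\<in>T. \<exists>x y. conflation C A x B y X}"

definition CoCone :: "('k, 'o, 'm, 'e, 'z) ext_cat_scheme \<Rightarrow> 'o set \<Rightarrow> 'o set \<Rightarrow> 'o set" where
  "CoCone C S T = {A. \<exists>B\<in>S. \<exists>X\<in>T. \<exists>x y. conflation C A x B y X}"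

definition Sigma_pow :: "('k, 'o, 'm, 'e, 'z) ext_cat_scheme \<Rightarrow> nat \<Rightarrow> 'o set \<Rightarrow> 'o set" where
  "Sigma_pow C n S = ((\<lambda>T. Cone C T (injectives C)) ^^ n) S"

definition Omega :: "('k, 'o, 'm, 'e, 'z) ext_cat_scheme \<Rightarrow> 'o set \<Rightarrow> 'o set" where
  "Omega C S = CoCone C (projectives C) S"

definition left_perp :: "('k, 'o, 'm, 'e, 'z) ext_cat_scheme \<Rightarrow> 'o set \<Rightarrow> 'o set" where
  "left_perp C S = {M \<in> obj C. \<forall>A\<in>S. ext C M A = {\<zero>\<^bsub>Ext C M A\<^esub>}}"

definition cotorsion_pair :: "('k, 'o, 'm, 'e, 'z) ext_cat_scheme \<Rightarrow> 'o set \<Rightarrow> 'o set \<Rightarrow> bool" where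
  "cotorsion_pair C S T \<longleftrightarrow>
    subcategory C S \<and> subcategory C T \<and>
    closed_under_summands C S \<and> closed_under_summands C T \<and>
    (\<forall>X\<in>S. \<forall>Y\<in>T. ext C X Y = {\<zero>\<^bsub>Ext C X Y\<^esub>}) \<and>
    (\<forall>D\<in>obj C.
      (\<exists>Y\<in>T. \<exists>X\<in>S. \<exists>y x. conflation C Y y X x D) \<and>
      (\<exists>Y\<in>T. \<exists>X\<in>S. \<exists>y x. conflation C D y Y x X))"

definition hereditary_cotorsion_pair ::
  "('k, 'o, 'm, 'e, 'z) ext_cat_scheme \<Rightarrow> 'o set \<Rightarrow> 'o set \<Rightarrow> bool" where
  "hereditary_cotorsion_pair C S T \<longleftrightarrow> cotorsion_pair C S T \<and> Omega C S \<subseteq> S"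

text \<open>The full subcategory on \<open>S\<close> with the \<open>\<bbbE>\<close>-triangles of \<open>C\<close> whose terms all lie in \<open>S\<close>.\<close>

definition full_sub ::
  "('k, 'o, 'm, 'e, 'z) ext_cat_scheme \<Rightarrow> 'o set \<Rightarrow> ('k, 'o, 'm, 'e, 'z) ext_cat_scheme" where
  "full_sub C S = C\<lparr>obj := S, rlz := (\<lambda>X A \<delta>. {(B, x, y) \<in> rlz C X A \<delta>. B \<in> S})\<rparr>"

definition iterated_Cone :: "('k, 'o, 'm, 'e, 'z) ext_cat_scheme \<Rightarrow> 'o set \<Rightarrow> nat \<Rightarrow> 'o set" where
  "iterated_Cone C W n = ((\<lambda>T. Cone C T W) ^^ n) W"

end

theory Submission
  imports Defs
begin

text \<open>
  The theorem is an instance of a general fact about intervals of cotorsion pairs. Let \<open>(U, V)\<close> and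
  \<open>(U\<^sub>1, V\<^sub>1)\<close> be hereditary cotorsion pairs with \<open>V\<^sub>1 \<subseteq> V\<close>, equivalently \<open>U \<subseteq> U\<^sub>1\<close>, and call
  \<open>H = V \<inter> U\<^sub>1\<close> the heart of the interval. Then \<open>(U', V') \<mapsto> (U' \<inter> V, V' \<inter> U\<^sub>1)\<close> is a bijection from the
  cotorsion pairs with \<open>U \<subseteq> U' \<subseteq> U\<^sub>1\<close> onto the cotorsion pairs in \<open>H\<close> (\<open>interval_bijection\<close>), with inverse
  \<open>(X, Y) \<mapsto> (U\<^sub>1 \<inter> \<^sup>\<bottom>Y, V \<inter> X\<^sup>\<bottom>)\<close>.

  Restriction works because heredity makes \<open>V\<close> closed under cones and \<open>U\<^sub>1\<close> closed under cocones: the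
  approximations of an object of \<open>H\<close> by \<open>(U', V')\<close> then stay inside \<open>H\<close>. The same closure properties
  recover \<open>U'\<close>: if \<open>M \<in> U\<^sub>1\<close> is orthogonal to \<open>V' \<inter> U\<^sub>1\<close>, the first term of its \<open>U'\<close>-approximation lies in
  \<open>V' \<inter> U\<^sub>1\<close>, so the approximation splits and \<open>M\<close> is a summand of an object of \<open>U'\<close>.

  For extension, the point is that every \<open>A\<close> in \<open>U\<^sub>1 \<inter> \<^sup>\<bottom>Y\<close> has a conflation \<open>A \<rightarrow> M \<rightarrow> P\<close> with \<open>M \<in> X\<close> and
  \<open>P \<in> U\<close> (\<open>U'_copresentation\<close>); as \<open>V\<close> is orthogonal to \<open>U\<close> also in degree two, \<open>\<bbbE>(A, B) = 0\<close> for \<open>B\<close> in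
  \<open>V \<inter> X\<^sup>\<bottom>\<close>. Approximations of an arbitrary object are glued by (ET4) from one for \<open>(U, V)\<close>, one for
  \<open>(U\<^sub>1, V\<^sub>1)\<close> and one in the heart.

  For the theorem take \<open>V\<^sub>1 = \<Sigma>\<^sup>iV\<close>. Heredity of \<open>(U, V)\<close> gives \<open>\<Sigma>V \<subseteq> V\<close>, hence \<open>\<Sigma>\<^sup>iV \<subseteq> V\<close> and
  \<open>\<Sigma>(\<Sigma>\<^sup>iV) \<subseteq> \<Sigma>\<^sup>iV\<close>, and the latter makes the second pair hereditary. Dimension shifting along
  conflations \<open>Z \<rightarrow> I \<rightarrow> Z'\<close> with \<open>I\<close> injective identifies the heart \<open>V \<inter> \<^sup>\<bottom>(\<Sigma>\<^sup>iV)\<close> with the iterated cone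
  \<open>W\<^sub>i\<close> (\<open>iterated_Cone_core\<close>). The degree two vanishing needed throughout is expressed without higher
  extension groups, by \<open>ext_cocone\<close> and \<open>ext_cone\<close>.
\<close>

definition right_perp :: "('k, 'o, 'm, 'e, 'z) ext_cat_scheme \<Rightarrow> 'o set \<Rightarrow> 'o set" where
  "right_perp C S = {N \<in> obj C. \<forall>X\<in>S. ext C X N = {\<zero>\<^bsub>Ext C X N\<^esub>}}"

lemma left_perp_antimono: "S \<subseteq> T \<Longrightarrow> left_perp C T \<subseteq> left_perp C S"
  by (auto simp: left_perp_def)

lemma right_perp_antimono: "S \<subseteq> T \<Longrightarrow> right_perp C T \<subseteq> right_perp C S"
  by (auto simp: right_perp_def)

section \<open>Splitting of the zero extension\<close>

lemma linear_map_zero: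
  assumes "field K" "module K M" "module K N" "linear_map K M N f"
  shows "f \<zero>\<^bsub>M\<^esub> = \<zero>\<^bsub>N\<^esub>"
proof -
  interpret M: module K M by fact
  interpret N: module K N by fact
  have "f \<zero>\<^bsub>M\<^esub> \<in> carrier N"
    using assms(4) M.zero_closed by (auto simp only: linear_map_def)
  moreover have "f (\<zero>\<^bsub>M\<^esub> \<oplus>\<^bsub>M\<^esub> \<zero>\<^bsub>M\<^esub>) = f \<zero>\<^bsub>M\<^esub> \<oplus>\<^bsub>N\<^esub> f \<zero>\<^bsub>M\<^esub>"
    using assms(4) M.zero_closed unfolding linear_map_def by blast
  ultimately show ?thesis
    using N.add.l_cancel_one by force
qed

context linear_category
begin

lemma cmp_arr:
  "\<lbrakk>f \<in> arr C A B; g \<in> arr C B D; A \<in> obj C; B \<in> obj C; D \<in> obj C\<rbrakk> \<Longrightarrow> g \<cdot>\<^bsub>C\<^esub> f \<in> arr C A D"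
  using cmp_linear_left unfolding linear_map_def by blast

lemma zero_arr: "\<lbrakk>A \<in> obj C; B \<in> obj C\<rbrakk> \<Longrightarrow> \<zero>\<^bsub>Hom C A B\<^esub> \<in> arr C A B"
  using Hom_module[of A B] abelian_group.axioms(1) abelian_monoid.zero_closed module.axioms(2)
  by metis

lemma cmp_zero_left:
  "\<lbrakk>f \<in> arr C A B; A \<in> obj C; B \<in> obj C; D \<in> obj C\<rbrakk> \<Longrightarrow> \<zero>\<^bsub>Hom C B D\<^esub> \<cdot>\<^bsub>C\<^esub> f = \<zero>\<^bsub>Hom C A D\<^esub>"
  using linear_map_zero[OF field_axioms Hom_module Hom_module cmp_linear_left] by blast

lemma biproduct_sym: "biproduct C A A' S i i' p p' \<Longrightarrow> biproduct C A' A S i' i p' p"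
proof -
  assume *: "biproduct C A A' S i i' p p'"
  then have o: "A \<in> obj C" "A' \<in> obj C" "S \<in> obj C"
    and a: "i \<in> arr C A S" "i' \<in> arr C A' S" "p \<in> arr C S A" "p' \<in> arr C S A'"
    by (auto simp: biproduct_def)
  interpret H: module K "Hom C S S" using Hom_module o by blast
  have "i \<cdot>\<^bsub>C\<^esub> p \<in> arr C S S" "i' \<cdot>\<^bsub>C\<^esub> p' \<in> arr C S S" using o a cmp_arr by blast+
  then have "(i' \<cdot>\<^bsub>C\<^esub> p') \<oplus>\<^bsub>Hom C S S\<^esub> (i \<cdot>\<^bsub>C\<^esub> p) = (i \<cdot>\<^bsub>C\<^esub> p) \<oplus>\<^bsub>Hom C S S\<^esub> (i' \<cdot>\<^bsub>C\<^esub> p')"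
    by (rule H.a_comm[rotated])
  then show ?thesis using * by (auto simp: biproduct_def)
qed

lemma biproduct_zero_object:
  assumes B: "B \<in> obj C" and Z: "zero_object C Z"
  shows "biproduct C B Z B (ident C B) \<zero>\<^bsub>Hom C Z B\<^esub> (ident C B) \<zero>\<^bsub>Hom C B Z\<^esub>"
proof -
  have Zo: "Z \<in> obj C" using Z by (simp add: zero_object_def)
  let ?u = "\<zero>\<^bsub>Hom C Z B\<^esub>" and ?v = "\<zero>\<^bsub>Hom C B Z\<^esub>"
  interpret HB: module K "Hom C B B" using Hom_module B by blast
  have uv: "?u \<in> arr C Z B" "?v \<in> arr C B Z" using zero_arr B Zo by blast+
  have iB: "ident C B \<in> arr C B B" using ident_arr B by blast
  have "?u \<cdot>\<^bsub>C\<^esub> ?v = \<zero>\<^bsub>Hom C B B\<^esub>" using cmp_zero_left[of ?v B Z B] uv B Zo by blast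
  moreover have "?v \<cdot>\<^bsub>C\<^esub> ?u = ident C Z"
    using cmp_arr[of ?u Z B ?v Z] ident_arr[of Z] Z uv B Zo by (auto simp: zero_object_def)
  ultimately show ?thesis
    using uv iB B Zo cmp_ident_left[of B B "ident C B"] cmp_ident_left[of Z B ?u]
      cmp_ident_right[of B Z ?v] HB.r_zero[of "ident C B"]
    unfolding biproduct_def by simp
qed

lemma is_iso_ident: "A \<in> obj C \<Longrightarrow> is_iso C A A (ident C A)"
  unfolding is_iso_def using ident_arr cmp_ident_left by metis

lemma is_iso_cmp:
  assumes o: "A \<in> obj C" "B \<in> obj C" "D \<in> obj C" and f: "is_iso C A B f" and g: "is_iso C B D g"
  shows "is_iso C A D (g \<cdot>\<^bsub>C\<^esub> f)"
proof -
  obtain f' where f': "f \<in> arr C A B" "f' \<in> arr C B A" "f' \<cdot>\<^bsub>C\<^esub> f = ident C A" "f \<cdot>\<^bsub>C\<^esub> f' = ident C B"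
    using f by (auto simp: is_iso_def)
  obtain g' where g': "g \<in> arr C B D" "g' \<in> arr C D B" "g' \<cdot>\<^bsub>C\<^esub> g = ident C B" "g \<cdot>\<^bsub>C\<^esub> g' = ident C D"
    using g by (auto simp: is_iso_def)
  have gf: "g \<cdot>\<^bsub>C\<^esub> f \<in> arr C A D" and fg: "f' \<cdot>\<^bsub>C\<^esub> g' \<in> arr C D A"
    using cmp_arr o f' g' by blast+
  have "(f' \<cdot>\<^bsub>C\<^esub> g') \<cdot>\<^bsub>C\<^esub> (g \<cdot>\<^bsub>C\<^esub> f) = f' \<cdot>\<^bsub>C\<^esub> (g' \<cdot>\<^bsub>C\<^esub> (g \<cdot>\<^bsub>C\<^esub> f))"
    using cmp_assoc[of A D B A] o f' g' gf by blast
  also have "g' \<cdot>\<^bsub>C\<^esub> (g \<cdot>\<^bsub>C\<^esub> f) = f"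
    using cmp_assoc[of A B D B f g g'] cmp_ident_left[of A B f] o f' g' by simp
  finally have 1: "(f' \<cdot>\<^bsub>C\<^esub> g') \<cdot>\<^bsub>C\<^esub> (g \<cdot>\<^bsub>C\<^esub> f) = ident C A" using f' by simp
  have "(g \<cdot>\<^bsub>C\<^esub> f) \<cdot>\<^bsub>C\<^esub> (f' \<cdot>\<^bsub>C\<^esub> g') = g \<cdot>\<^bsub>C\<^esub> (f \<cdot>\<^bsub>C\<^esub> (f' \<cdot>\<^bsub>C\<^esub> g'))"
    using cmp_assoc[of D A B D] o f' g' fg by blast
  also have "f \<cdot>\<^bsub>C\<^esub> (f' \<cdot>\<^bsub>C\<^esub> g') = g'"
    using cmp_assoc[of D B A B g' f' f] cmp_ident_left[of D B g'] o f' g' by simp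
  finally have 2: "(g \<cdot>\<^bsub>C\<^esub> f) \<cdot>\<^bsub>C\<^esub> (f' \<cdot>\<^bsub>C\<^esub> g') = ident C D" using g' by simp
  show ?thesis using 1 2 gf fg by (auto simp: is_iso_def)
qed

text \<open>
  Transport along an isomorphism of middle terms. The projection onto \<open>X\<close> is prescribed, since it has
  to be the deflation of a given \<open>\<bbbE>\<close>-triangle.
\<close>

lemma biproduct_iso:
  assumes S: "biproduct C A X S i i' p p'" and T: "T \<in> obj C" and b: "is_iso C S T b"
    and y: "y \<in> arr C T X" "y \<cdot>\<^bsub>C\<^esub> b = p'"
  shows "\<exists>q. biproduct C A X T (b \<cdot>\<^bsub>C\<^esub> i) (b \<cdot>\<^bsub>C\<^esub> i') q y"
proof -
  have o: "A \<in> obj C" "X \<in> obj C" "S \<in> obj C"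
    and a: "i \<in> arr C A S" "i' \<in> arr C X S" "p \<in> arr C S A" "p' \<in> arr C S X"
    and eq: "p \<cdot>\<^bsub>C\<^esub> i = ident C A" "p' \<cdot>\<^bsub>C\<^esub> i' = ident C X"
      "p \<cdot>\<^bsub>C\<^esub> i' = \<zero>\<^bsub>Hom C X A\<^esub>" "p' \<cdot>\<^bsub>C\<^esub> i = \<zero>\<^bsub>Hom C A X\<^esub>"
      "(i \<cdot>\<^bsub>C\<^esub> p) \<oplus>\<^bsub>Hom C S S\<^esub> (i' \<cdot>\<^bsub>C\<^esub> p') = ident C S"
    using S by (auto simp: biproduct_def)
  obtain c where c: "b \<in> arr C S T" "c \<in> arr C T S" "c \<cdot>\<^bsub>C\<^esub> b = ident C S" "b \<cdot>\<^bsub>C\<^esub> c = ident C T"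
    using b by (auto simp: is_iso_def)
  have y': "y = p' \<cdot>\<^bsub>C\<^esub> c"
    using cmp_assoc[of T S T X c b y] cmp_ident_right[of T X y] o T c y by simp
  have bi: "b \<cdot>\<^bsub>C\<^esub> i \<in> arr C A T" "b \<cdot>\<^bsub>C\<^esub> i' \<in> arr C X T" and pc: "p \<cdot>\<^bsub>C\<^esub> c \<in> arr C T A"
    using cmp_arr o T a c by blast+
  have cb: "c \<cdot>\<^bsub>C\<^esub> (b \<cdot>\<^bsub>C\<^esub> f) = f" if "f \<in> arr C Z S" "Z \<in> obj C" for f Z
    using cmp_assoc[of Z S T S f b c] cmp_ident_left[of Z S f] o T c that by simp
  have qb: "(q \<cdot>\<^bsub>C\<^esub> c) \<cdot>\<^bsub>C\<^esub> (b \<cdot>\<^bsub>C\<^esub> f) = q \<cdot>\<^bsub>C\<^esub> f"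
    if "f \<in> arr C Z S" "Z \<in> obj C" "q \<in> arr C S Y" "Y \<in> obj C" for f Z q Y
    using cmp_assoc[of Z T S Y "b \<cdot>\<^bsub>C\<^esub> f" c q] cb[of f Z] cmp_arr[of f Z S b T] o T c that by simp
  have conj: "(b \<cdot>\<^bsub>C\<^esub> f) \<cdot>\<^bsub>C\<^esub> (q \<cdot>\<^bsub>C\<^esub> c) = (b \<cdot>\<^bsub>C\<^esub> (f \<cdot>\<^bsub>C\<^esub> q)) \<cdot>\<^bsub>C\<^esub> c"
    if "f \<in> arr C Z S" "Z \<in> obj C" "q \<in> arr C S Z" for f Z q
    using cmp_assoc[of T S Z T c q "b \<cdot>\<^bsub>C\<^esub> f"] cmp_assoc[of S Z S T q f b] cmp_arr[of f Z S b T] o T c that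
    by simp
  have ip: "i \<cdot>\<^bsub>C\<^esub> p \<in> arr C S S" "i' \<cdot>\<^bsub>C\<^esub> p' \<in> arr C S S" using cmp_arr o a by blast+
  have bip: "b \<cdot>\<^bsub>C\<^esub> (i \<cdot>\<^bsub>C\<^esub> p) \<in> arr C S T" "b \<cdot>\<^bsub>C\<^esub> (i' \<cdot>\<^bsub>C\<^esub> p') \<in> arr C S T" using cmp_arr ip o T c by blast+
  have L: "linear_map K (Hom C S S) (Hom C S T) (\<lambda>f. b \<cdot>\<^bsub>C\<^esub> f)"
    "linear_map K (Hom C S T) (Hom C T T) (\<lambda>g. g \<cdot>\<^bsub>C\<^esub> c)"
    using cmp_linear_right[of S S T b] cmp_linear_left[of T S T c] o T c by blast+
  have "((b \<cdot>\<^bsub>C\<^esub> i) \<cdot>\<^bsub>C\<^esub> (p \<cdot>\<^bsub>C\<^esub> c)) \<oplus>\<^bsub>Hom C T T\<^esub> ((b \<cdot>\<^bsub>C\<^esub> i') \<cdot>\<^bsub>C\<^esub> (p' \<cdot>\<^bsub>C\<^esub> c))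
      = ((b \<cdot>\<^bsub>C\<^esub> (i \<cdot>\<^bsub>C\<^esub> p)) \<cdot>\<^bsub>C\<^esub> c) \<oplus>\<^bsub>Hom C T T\<^esub> ((b \<cdot>\<^bsub>C\<^esub> (i' \<cdot>\<^bsub>C\<^esub> p')) \<cdot>\<^bsub>C\<^esub> c)"
    using conj[of i A p] conj[of i' X p'] o a by simp
  also have "\<dots> = (b \<cdot>\<^bsub>C\<^esub> ((i \<cdot>\<^bsub>C\<^esub> p) \<oplus>\<^bsub>Hom C S S\<^esub> (i' \<cdot>\<^bsub>C\<^esub> p'))) \<cdot>\<^bsub>C\<^esub> c"
    using L ip bip unfolding linear_map_def by simp
  also have "\<dots> = ident C T" using eq cmp_ident_right[of S T b] o T c by simp
  finally have "((b \<cdot>\<^bsub>C\<^esub> i) \<cdot>\<^bsub>C\<^esub> (p \<cdot>\<^bsub>C\<^esub> c)) \<oplus>\<^bsub>Hom C T T\<^esub> ((b \<cdot>\<^bsub>C\<^esub> i') \<cdot>\<^bsub>C\<^esub> y) = ident C T"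
    by (simp add: y')
  then have "biproduct C A X T (b \<cdot>\<^bsub>C\<^esub> i) (b \<cdot>\<^bsub>C\<^esub> i') (p \<cdot>\<^bsub>C\<^esub> c) y"
    using qb[of i A p A] qb[of i' X p A] qb[of i A p' X] qb[of i' X p' X] o T a bi pc y(1) eq
    unfolding biproduct_def y' by simp
  then show ?thesis ..
qed

end

context extriangulated_category
begin

lemma etriangleD:
  assumes "etriangle C A x B y X \<delta>"
  shows "A \<in> obj C" "B \<in> obj C" "X \<in> obj C" "x \<in> arr C A B" "y \<in> arr C B X" "\<delta> \<in> ext C X A"
  using assms by (auto simp: etriangle_def)

lemma conflation_obj:
  assumes "conflation C A x B y X"
  shows "A \<in> obj C" "B \<in> obj C" "X \<in> obj C"
  using assms etriangleD unfolding conflation_def by blast+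

lemma zero_ext: "\<lbrakk>X \<in> obj C; A \<in> obj C\<rbrakk> \<Longrightarrow> \<zero>\<^bsub>Ext C X A\<^esub> \<in> ext C X A"
  using Ext_module[of X A] abelian_group.axioms(1) abelian_monoid.zero_closed module.axioms(2)
  by metis

lemma ext_trivial_iff:
  "\<lbrakk>X \<in> obj C; A \<in> obj C\<rbrakk> \<Longrightarrow> ext C X A = {\<zero>\<^bsub>Ext C X A\<^esub>} \<longleftrightarrow> (\<forall>\<epsilon>\<in>ext C X A. \<epsilon> = \<zero>\<^bsub>Ext C X A\<^esub>)"
  using zero_ext by blast

lemma push_ext:
  "\<lbrakk>\<delta> \<in> ext C X A; a \<in> arr C A A'; X \<in> obj C; A \<in> obj C; A' \<in> obj C\<rbrakk> \<Longrightarrow> push C a \<delta> \<in> ext C X A'"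
  using push_linear unfolding linear_map_def by blast

lemma pull_ext:
  "\<lbrakk>\<delta> \<in> ext C X A; c \<in> arr C X' X; X \<in> obj C; X' \<in> obj C; A \<in> obj C\<rbrakk> \<Longrightarrow> pull C c \<delta> \<in> ext C X' A"
  using pull_linear unfolding linear_map_def by blast

lemma push_zero:
  "\<lbrakk>a \<in> arr C A A'; X \<in> obj C; A \<in> obj C; A' \<in> obj C\<rbrakk> \<Longrightarrow> push C a \<zero>\<^bsub>Ext C X A\<^esub> = \<zero>\<^bsub>Ext C X A'\<^esub>"
  using linear_map_zero[OF field_axioms Ext_module Ext_module push_linear] by blast

lemma pull_zero:
  "\<lbrakk>c \<in> arr C X' X; X \<in> obj C; X' \<in> obj C; A \<in> obj C\<rbrakk> \<Longrightarrow> pull C c \<zero>\<^bsub>Ext C X A\<^esub> = \<zero>\<^bsub>Ext C X' A\<^esub>"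
  using linear_map_zero[OF field_axioms Ext_module Ext_module pull_linear] by blast

lemma etriangle_exists:
  assumes "X \<in> obj C" "A \<in> obj C" "\<delta> \<in> ext C X A"
  shows "\<exists>B x y. etriangle C A x B y X \<delta>"
proof -
  obtain s where s: "s \<in> sequences C X A" "rlz C X A \<delta> = seq_equiv C X A `` {s}"
    using rlz_class[OF assms] by (auto elim: quotientE)
  obtain B x y where b: "s = (B, x, y)" by (cases s)
  have B: "B \<in> obj C" "x \<in> arr C A B" "y \<in> arr C B X" using s b by (auto simp: sequences_def)
  have "is_iso C B B (ident C B) \<and> ident C B \<cdot>\<^bsub>C\<^esub> x = x \<and> y \<cdot>\<^bsub>C\<^esub> ident C B = y"
    using is_iso_ident cmp_ident_left cmp_ident_right assms B by blast
  then have "(s, s) \<in> seq_equiv C X A" using s(1) unfolding b seq_equiv_def by blast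
  then have "(B, x, y) \<in> rlz C X A \<delta>" using s b by auto
  then show ?thesis using B assms unfolding etriangle_def by blast
qed

lemma etriangle_unique:
  assumes "etriangle C A x B y X \<delta>" "etriangle C A x' B' y' X \<delta>"
  shows "\<exists>b. is_iso C B B' b \<and> b \<cdot>\<^bsub>C\<^esub> x = x' \<and> y' \<cdot>\<^bsub>C\<^esub> b = y"
proof -
  note o = etriangleD[OF assms(1)] etriangleD[OF assms(2)]
  obtain s where s: "s \<in> sequences C X A" "rlz C X A \<delta> = seq_equiv C X A `` {s}"
    using rlz_class[of X A \<delta>] o by (auto elim: quotientE)
  obtain S u v where b: "s = (S, u, v)" by (cases s)
  have S: "S \<in> obj C" "u \<in> arr C A S" "v \<in> arr C S X" using s b by (auto simp: sequences_def)
  have r: "(s, (B, x, y)) \<in> seq_equiv C X A" "(s, (B', x', y')) \<in> seq_equiv C X A"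
    using assms s(2) by (auto simp: etriangle_def)
  obtain f where f: "is_iso C S B f" "f \<cdot>\<^bsub>C\<^esub> u = x" "y \<cdot>\<^bsub>C\<^esub> f = v"
    using r(1) unfolding seq_equiv_def b by blast
  obtain g where g: "is_iso C S B' g" "g \<cdot>\<^bsub>C\<^esub> u = x'" "y' \<cdot>\<^bsub>C\<^esub> g = v"
    using r(2) unfolding seq_equiv_def b by blast
  obtain h where h: "f \<in> arr C S B" "h \<in> arr C B S" "h \<cdot>\<^bsub>C\<^esub> f = ident C S" "f \<cdot>\<^bsub>C\<^esub> h = ident C B"
    using f by (auto simp: is_iso_def)
  have gA: "g \<in> arr C S B'" using g by (auto simp: is_iso_def)
  have "is_iso C B S h" using h by (auto simp: is_iso_def)
  then have 1: "is_iso C B B' (g \<cdot>\<^bsub>C\<^esub> h)" using is_iso_cmp g o S by blast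
  have "h \<cdot>\<^bsub>C\<^esub> x = u" using cmp_assoc[of A S B S u f h] cmp_ident_left[of A S u] f(2) o S h by simp
  then have 2: "(g \<cdot>\<^bsub>C\<^esub> h) \<cdot>\<^bsub>C\<^esub> x = x'"
    using cmp_assoc[of A B S B' x h g] g(2) o S h gA by simp
  have "v \<cdot>\<^bsub>C\<^esub> h = y" using cmp_assoc[of B S B X h f y] cmp_ident_right[of B X y] f(3) o S h by simp
  then have 3: "y' \<cdot>\<^bsub>C\<^esub> (g \<cdot>\<^bsub>C\<^esub> h) = y"
    using cmp_assoc[of B S B' X h g y'] g(3) o S h gA by simp
  show ?thesis using 1 2 3 by blast
qed

lemma zero_etriangle:
  assumes "biproduct C A X S i i' p p'"
  shows "etriangle C A i S p' X \<zero>\<^bsub>Ext C X A\<^esub>"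
  using assms rlz_zero[OF assms] zero_ext by (auto simp: etriangle_def biproduct_def)

text \<open>
  A direct sum realizes the zero extension, and any two realizations of an extension are equivalent.
\<close>

lemma etriangle_zero_splits:
  assumes "etriangle C A x B y X \<zero>\<^bsub>Ext C X A\<^esub>"
  shows "\<exists>s r. biproduct C A X B x s r y"
proof -
  note o = etriangleD[OF assms]
  obtain S i i' p p' where S: "biproduct C A X S i i' p p'" using has_biproducts o by blast
  obtain b where "is_iso C S B b" "b \<cdot>\<^bsub>C\<^esub> i = x" "y \<cdot>\<^bsub>C\<^esub> b = p'"
    using etriangle_unique[OF zero_etriangle[OF S] assms] by blast
  then show ?thesis using biproduct_iso[OF S o(2) _ o(5)] by blast
qed

lemma conflation_splits:
  assumes "conflation C A x B y X" "ext C X A = {\<zero>\<^bsub>Ext C X A\<^esub>}"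
  shows "\<exists>s r. biproduct C A X B x s r y"
proof -
  obtain \<delta> where d: "etriangle C A x B y X \<delta>" using assms(1) unfolding conflation_def by blast
  then have "\<delta> = \<zero>\<^bsub>Ext C X A\<^esub>" using etriangleD(6) assms(2) by blast
  then show ?thesis using d etriangle_zero_splits by blast
qed

section \<open>Exact sequences\<close>

text \<open>
  By (ET3), comparing the triangle with \<open>B \<rightarrow> B \<rightarrow> 0\<close> along \<open>x\<close> exhibits \<open>x\<^sub>* \<delta>\<close> as a pullback of an
  extension of the zero object. The dual lemma compares with \<open>0 \<rightarrow> B \<rightarrow> B\<close>.
\<close>

lemma push_inflation_zero:
  assumes d: "etriangle C A x B y X \<delta>"
  shows "push C x \<delta> = \<zero>\<^bsub>Ext C X B\<^esub>"
proof -
  note o = etriangleD[OF d]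
  obtain Z where Z: "zero_object C Z" using has_zero_object by blast
  note t = zero_etriangle[OF biproduct_zero_object[OF o(2) Z]]
  obtain c where "c \<in> arr C X Z" "push C x \<delta> = pull C c \<zero>\<^bsub>Ext C Z B\<^esub>"
    using et3[OF d t o(4) ident_arr[OF o(2)]] by blast
  moreover have "Z \<in> obj C" using Z by (simp add: zero_object_def)
  ultimately show ?thesis using pull_zero[of c X Z B] o by simp
qed

lemma pull_deflation_zero:
  assumes d: "etriangle C A x B y X \<delta>"
  shows "pull C y \<delta> = \<zero>\<^bsub>Ext C B A\<^esub>"
proof -
  note o = etriangleD[OF d]
  obtain Z where Z: "zero_object C Z" using has_zero_object by blast
  note t = zero_etriangle[OF biproduct_sym[OF biproduct_zero_object[OF o(2) Z]]]
  obtain a where "a \<in> arr C Z A" "push C a \<zero>\<^bsub>Ext C B Z\<^esub> = pull C y \<delta>"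
    using et3_op[OF t d ident_arr[OF o(2)] o(5)] by blast
  moreover have "Z \<in> obj C" using Z by (simp add: zero_object_def)
  ultimately show ?thesis using push_zero[of a Z A B] o by simp
qed

text \<open>
  The triangle maps to the split one over the identity of \<open>X\<close>, and the split one retracts onto \<open>Z\<close>.
\<close>

lemma factor_through_inflation:
  assumes d: "etriangle C A x B y X \<delta>" and f: "f \<in> arr C A Z" "Z \<in> obj C"
    and 0: "push C f \<delta> = \<zero>\<^bsub>Ext C X Z\<^esub>"
  shows "\<exists>g\<in>arr C B Z. g \<cdot>\<^bsub>C\<^esub> x = f"
proof -
  note o = etriangleD[OF d]
  obtain S i i' p p' where S: "biproduct C Z X S i i' p p'" using has_biproducts o f by blast
  have a: "S \<in> obj C" "i \<in> arr C Z S" "p \<in> arr C S Z" "p \<cdot>\<^bsub>C\<^esub> i = ident C Z"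
    using S by (auto simp: biproduct_def)
  have "push C f \<delta> = pull C (ident C X) \<zero>\<^bsub>Ext C X Z\<^esub>" using 0 pull_ident zero_ext o f by simp
  then obtain b where b: "b \<in> arr C B S" "b \<cdot>\<^bsub>C\<^esub> x = i \<cdot>\<^bsub>C\<^esub> f"
    using rlz_morphism[OF d zero_etriangle[OF S] f(1) ident_arr[OF o(3)]] by blast
  have "(p \<cdot>\<^bsub>C\<^esub> b) \<cdot>\<^bsub>C\<^esub> x = p \<cdot>\<^bsub>C\<^esub> (i \<cdot>\<^bsub>C\<^esub> f)" using cmp_assoc[of A B S Z x b p] o a b f by simp
  also have "\<dots> = f" using cmp_assoc[of A Z S Z f i p] cmp_ident_left[of A Z f] o a f by simp
  finally show ?thesis using cmp_arr[of b B S p Z] o a b f by blast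
qed

lemma factor_through_deflation:
  assumes d: "etriangle C A x B y X \<delta>" and f: "f \<in> arr C Z X" "Z \<in> obj C"
    and 0: "pull C f \<delta> = \<zero>\<^bsub>Ext C Z A\<^esub>"
  shows "\<exists>g\<in>arr C Z B. y \<cdot>\<^bsub>C\<^esub> g = f"
proof -
  note o = etriangleD[OF d]
  obtain S i i' p p' where S: "biproduct C A Z S i i' p p'" using has_biproducts o f by blast
  have a: "S \<in> obj C" "i' \<in> arr C Z S" "p' \<in> arr C S Z" "p' \<cdot>\<^bsub>C\<^esub> i' = ident C Z"
    using S by (auto simp: biproduct_def)
  have "push C (ident C A) \<zero>\<^bsub>Ext C Z A\<^esub> = pull C f \<delta>" using 0 push_ident zero_ext o f by simp
  then obtain b where b: "b \<in> arr C S B" "y \<cdot>\<^bsub>C\<^esub> b = f \<cdot>\<^bsub>C\<^esub> p'"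
    using rlz_morphism[OF zero_etriangle[OF S] d ident_arr[OF o(1)] f(1)] by blast
  have "y \<cdot>\<^bsub>C\<^esub> (b \<cdot>\<^bsub>C\<^esub> i') = (f \<cdot>\<^bsub>C\<^esub> p') \<cdot>\<^bsub>C\<^esub> i'" using cmp_assoc[of Z S B X i' b y] o a b f by simp
  also have "\<dots> = f" using cmp_assoc[of Z S Z X i' p' f] cmp_ident_right[of Z X f] o a f by simp
  finally show ?thesis using cmp_arr[of i' Z S b B] o a b f by blast
qed

text \<open>
  Realize \<open>\<epsilon>\<close> as \<open>Z \<rightarrow> E \<rightarrow> X\<close>. Since \<open>y\<^sup>* \<epsilon> = 0\<close>, the deflation \<open>y\<close> lifts to \<open>E\<close>, and the dual of (ET3)
  completes the lift to a morphism of triangles.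
\<close>

lemma ext_in_image_of_connecting_push:
  assumes d: "etriangle C A x B y X \<delta>" and e: "\<epsilon> \<in> ext C X Z" "Z \<in> obj C"
    and 0: "pull C y \<epsilon> = \<zero>\<^bsub>Ext C B Z\<^esub>"
  shows "\<exists>f\<in>arr C A Z. push C f \<delta> = \<epsilon>"
proof -
  note o = etriangleD[OF d]
  obtain E u v where t: "etriangle C Z u E v X \<epsilon>" using etriangle_exists o e by blast
  note oE = etriangleD[OF t]
  obtain g where g: "g \<in> arr C B E" "v \<cdot>\<^bsub>C\<^esub> g = y"
    using factor_through_deflation[OF t o(5,2) 0] by blast
  then have "ident C X \<cdot>\<^bsub>C\<^esub> y = v \<cdot>\<^bsub>C\<^esub> g" using cmp_ident_left o by simp
  then obtain f where "f \<in> arr C A Z" "push C f \<delta> = pull C (ident C X) \<epsilon>"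
    using et3_op[OF d t g(1) ident_arr[OF o(3)]] by blast
  then show ?thesis using pull_ident o e by auto
qed

lemma ext_in_image_of_connecting_pull:
  assumes d: "etriangle C A x B y X \<delta>" and e: "\<epsilon> \<in> ext C Z A" "Z \<in> obj C"
    and 0: "push C x \<epsilon> = \<zero>\<^bsub>Ext C Z B\<^esub>"
  shows "\<exists>f\<in>arr C Z X. pull C f \<delta> = \<epsilon>"
proof -
  note o = etriangleD[OF d]
  obtain E u v where t: "etriangle C A u E v Z \<epsilon>" using etriangle_exists o e by blast
  note oE = etriangleD[OF t]
  obtain g where g: "g \<in> arr C E B" "g \<cdot>\<^bsub>C\<^esub> u = x"
    using factor_through_inflation[OF t o(4,2) 0] by blast
  then have "g \<cdot>\<^bsub>C\<^esub> u = x \<cdot>\<^bsub>C\<^esub> ident C A" using cmp_ident_right o by simp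
  then obtain f where "f \<in> arr C Z X" "push C (ident C A) \<epsilon> = pull C f \<delta>"
    using et3[OF t d ident_arr[OF o(1)] g(1)] by blast
  then show ?thesis using push_ident o e by auto
qed

text \<open>
  Exactness of \<open>\<bbbE>(X, Z) \<rightarrow> \<bbbE>(B, Z) \<rightarrow> \<bbbE>(A, Z)\<close> in the middle. The dual of (ET4) realizes \<open>x\<^sup>* \<epsilon>\<close>
  by a conflation \<open>Z \<rightarrow> F \<rightarrow> A\<close> such that \<open>\<epsilon>\<close> becomes a pullback along \<open>y\<close> once pushed out to \<open>F\<close>. This
  conflation splits, and a retraction \<open>F \<rightarrow> Z\<close> shows that \<open>\<epsilon>\<close> itself is pulled back from \<open>\<bbbE>(X, Z) = 0\<close>.
\<close>

lemma ext_middle_left: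
  assumes c: "conflation C A x B y X" and Z: "Z \<in> obj C"
    and A: "ext C A Z = {\<zero>\<^bsub>Ext C A Z\<^esub>}" and X: "ext C X Z = {\<zero>\<^bsub>Ext C X Z\<^esub>}"
  shows "ext C B Z = {\<zero>\<^bsub>Ext C B Z\<^esub>}"
proof -
  obtain \<delta> where d: "etriangle C A x B y X \<delta>" using c unfolding conflation_def by blast
  note o = etriangleD[OF d]
  have "\<epsilon> = \<zero>\<^bsub>Ext C B Z\<^esub>" if e: "\<epsilon> \<in> ext C B Z" for \<epsilon>
  proof -
    obtain E u v where t: "etriangle C Z u E v B \<epsilon>" using etriangle_exists o Z e by blast
    note oE = etriangleD[OF t]
    obtain F h a b \<eta> where F: "etriangle C F h E (y \<cdot>\<^bsub>C\<^esub> v) X \<eta>"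
      "etriangle C Z a F b A (pull C x \<epsilon>)" "push C a \<epsilon> = pull C y \<eta>"
      using et4_op[OF t d] by blast
    note oF = etriangleD[OF F(1)] etriangleD[OF F(2)]
    have "conflation C Z a F b A" using F(2) unfolding conflation_def by blast
    then obtain s r where "biproduct C Z A F a s r b" using conflation_splits A by blast
    then have r: "r \<in> arr C F Z" "r \<cdot>\<^bsub>C\<^esub> a = ident C Z" by (auto simp: biproduct_def)
    have "\<epsilon> = push C r (push C a \<epsilon>)"
      using push_cmp[of B Z F Z a r \<epsilon>] push_ident[of B Z \<epsilon>] r o oF Z e by simp
    also have "\<dots> = pull C y (push C r \<eta>)"
      using push_pull[of X B F Z r y \<eta>] F(3) r o oF Z by simp
    also have "push C r \<eta> = \<zero>\<^bsub>Ext C X Z\<^esub>" using push_ext[of \<eta> X F r Z] r o oF Z X by auto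
    finally show ?thesis using pull_zero o Z by auto
  qed
  then show ?thesis using ext_trivial_iff o Z by blast
qed

lemma ext_middle_right:
  assumes c: "conflation C A x B y X" and Z: "Z \<in> obj C"
    and A: "ext C Z A = {\<zero>\<^bsub>Ext C Z A\<^esub>}" and X: "ext C Z X = {\<zero>\<^bsub>Ext C Z X\<^esub>}"
  shows "ext C Z B = {\<zero>\<^bsub>Ext C Z B\<^esub>}"
proof -
  obtain \<delta> where d: "etriangle C A x B y X \<delta>" using c unfolding conflation_def by blast
  note o = etriangleD[OF d]
  have "\<epsilon> = \<zero>\<^bsub>Ext C Z B\<^esub>" if e: "\<epsilon> \<in> ext C Z B" for \<epsilon>
  proof -
    obtain E u v where t: "etriangle C B u E v Z \<epsilon>" using etriangle_exists o Z e by blast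
    note oE = etriangleD[OF t]
    obtain F h a b \<eta> where F: "etriangle C A (u \<cdot>\<^bsub>C\<^esub> x) E h F \<eta>"
      "etriangle C X a F b Z (push C y \<epsilon>)" "push C x \<eta> = pull C b \<epsilon>"
      using et4[OF d t] by blast
    note oF = etriangleD[OF F(1)] etriangleD[OF F(2)]
    have "conflation C X a F b Z" using F(2) unfolding conflation_def by blast
    then obtain s r where "biproduct C X Z F a s r b" using conflation_splits X by blast
    then have s: "s \<in> arr C Z F" "b \<cdot>\<^bsub>C\<^esub> s = ident C Z" by (auto simp: biproduct_def)
    have "\<epsilon> = pull C s (pull C b \<epsilon>)"
      using pull_cmp[of Z F Z B b s \<epsilon>] pull_ident[of Z B \<epsilon>] s o oF Z e by simp
    also have "\<dots> = push C x (pull C s \<eta>)"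
      using push_pull[of F Z A B x s \<eta>] F(3) s o oF Z by simp
    also have "pull C s \<eta> = \<zero>\<^bsub>Ext C Z A\<^esub>" using pull_ext[of \<eta> F A s Z] s o oF Z A by auto
    finally show ?thesis using push_zero o Z by auto
  qed
  then show ?thesis using ext_trivial_iff o Z by blast
qed

lemma ext_retract_left:
  assumes o: "A \<in> obj C" "B \<in> obj C" "Z \<in> obj C" and B: "ext C B Z = {\<zero>\<^bsub>Ext C B Z\<^esub>}"
    and a: "i \<in> arr C A B" "p \<in> arr C B A" "p \<cdot>\<^bsub>C\<^esub> i = ident C A"
  shows "ext C A Z = {\<zero>\<^bsub>Ext C A Z\<^esub>}"
proof -
  have "\<epsilon> = \<zero>\<^bsub>Ext C A Z\<^esub>" if e: "\<epsilon> \<in> ext C A Z" for \<epsilon>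
  proof -
    have "pull C p \<epsilon> = \<zero>\<^bsub>Ext C B Z\<^esub>" using pull_ext[of \<epsilon> A Z p B] o a e B by auto
    then show ?thesis
      using pull_cmp[of A B A Z p i \<epsilon>] pull_ident[of A Z \<epsilon>] pull_zero[of i A B Z] o a e by simp
  qed
  then show ?thesis using ext_trivial_iff o by blast
qed

lemma ext_retract_right:
  assumes o: "A \<in> obj C" "B \<in> obj C" "Z \<in> obj C" and B: "ext C Z B = {\<zero>\<^bsub>Ext C Z B\<^esub>}"
    and a: "i \<in> arr C A B" "p \<in> arr C B A" "p \<cdot>\<^bsub>C\<^esub> i = ident C A"
  shows "ext C Z A = {\<zero>\<^bsub>Ext C Z A\<^esub>}"
proof -
  have "\<epsilon> = \<zero>\<^bsub>Ext C Z A\<^esub>" if e: "\<epsilon> \<in> ext C Z A" for \<epsilon>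
  proof -
    have "push C i \<epsilon> = \<zero>\<^bsub>Ext C Z B\<^esub>" using push_ext[of \<epsilon> Z A i B] o a e B by auto
    then show ?thesis
      using push_cmp[of Z A B A i p \<epsilon>] push_ident[of Z A \<epsilon>] push_zero[of p B A Z] o a e by simp
  qed
  then show ?thesis using ext_trivial_iff o by blast
qed

lemma ext_injective:
  assumes I: "injective C I" and M: "M \<in> obj C"
  shows "ext C M I = {\<zero>\<^bsub>Ext C M I\<^esub>}"
proof -
  have Io: "I \<in> obj C" using I by (simp add: injective_def)
  have "\<epsilon> = \<zero>\<^bsub>Ext C M I\<^esub>" if e: "\<epsilon> \<in> ext C M I" for \<epsilon>
  proof -
    obtain E u v where t: "etriangle C I u E v M \<epsilon>" using etriangle_exists M Io e by blast
    note o = etriangleD[OF t]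
    have "conflation C I u E v M" using t unfolding conflation_def by blast
    then obtain r where r: "r \<in> arr C E I" "r \<cdot>\<^bsub>C\<^esub> u = ident C I"
      using I ident_arr[OF Io] unfolding injective_def by blast
    then show ?thesis
      using push_cmp[of M I E I u r \<epsilon>] push_ident[of M I \<epsilon>] push_zero[of r E I M]
        push_inflation_zero[OF t] o by simp
  qed
  then show ?thesis using ext_trivial_iff M Io by blast
qed

lemma ext_projective:
  assumes P: "projective C P" and M: "M \<in> obj C"
  shows "ext C P M = {\<zero>\<^bsub>Ext C P M\<^esub>}"
proof -
  have Po: "P \<in> obj C" using P by (simp add: projective_def)
  have "\<epsilon> = \<zero>\<^bsub>Ext C P M\<^esub>" if e: "\<epsilon> \<in> ext C P M" for \<epsilon>
  proof -
    obtain E u v where t: "etriangle C M u E v P \<epsilon>" using etriangle_exists M Po e by blast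
    note o = etriangleD[OF t]
    have "conflation C M u E v P" using t unfolding conflation_def by blast
    then obtain s where s: "s \<in> arr C P E" "v \<cdot>\<^bsub>C\<^esub> s = ident C P"
      using P ident_arr[OF Po] unfolding projective_def by blast
    then show ?thesis
      using pull_cmp[of P E P M v s \<epsilon>] pull_ident[of P M \<epsilon>] pull_zero[of s P E M]
        pull_deflation_zero[OF t] o by simp
  qed
  then show ?thesis using ext_trivial_iff M Po by blast
qed

text \<open>
  Dimension shifting: as \<open>I\<close> is injective, \<open>\<bbbE>(X, Z')\<close> plays the role of \<open>\<bbbE>\<^sup>2(X, Z)\<close> and the statement is
  exactness of \<open>\<bbbE>(B, Z) \<rightarrow> \<bbbE>(A, Z) \<rightarrow> \<bbbE>\<^sup>2(X, Z)\<close>. An extension of \<open>A\<close> by \<open>Z\<close> is classified by a morphism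
  \<open>A \<rightarrow> Z'\<close>; this extends to \<open>B\<close>, so the extension is pulled back from \<open>\<bbbE>(B, Z)\<close>.
\<close>

lemma ext_cocone:
  assumes c: "conflation C A x B y X" and z: "conflation C Z z I w Z'" and I: "injective C I"
    and X: "ext C X Z' = {\<zero>\<^bsub>Ext C X Z'\<^esub>}" and B: "ext C B Z = {\<zero>\<^bsub>Ext C B Z\<^esub>}"
  shows "ext C A Z = {\<zero>\<^bsub>Ext C A Z\<^esub>}"
proof -
  obtain \<delta> where d: "etriangle C A x B y X \<delta>" using c unfolding conflation_def by blast
  obtain \<zeta> where t: "etriangle C Z z I w Z' \<zeta>" using z unfolding conflation_def by blast
  note o = etriangleD[OF d] etriangleD[OF t]
  have "\<epsilon> = \<zero>\<^bsub>Ext C A Z\<^esub>" if e: "\<epsilon> \<in> ext C A Z" for \<epsilon>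
  proof -
    have "push C z \<epsilon> = \<zero>\<^bsub>Ext C A I\<^esub>" using push_ext[of \<epsilon> A Z z I] ext_injective[OF I] o e by auto
    then obtain f where f: "f \<in> arr C A Z'" "pull C f \<zeta> = \<epsilon>"
      using ext_in_image_of_connecting_pull[OF t e] o by blast
    have "push C f \<delta> = \<zero>\<^bsub>Ext C X Z'\<^esub>" using push_ext[of \<delta> X A f Z'] X o f by auto
    then obtain g where g: "g \<in> arr C B Z'" "g \<cdot>\<^bsub>C\<^esub> x = f"
      using factor_through_inflation[OF d f(1)] o by blast
    have "pull C g \<zeta> = \<zero>\<^bsub>Ext C B Z\<^esub>" using pull_ext[of \<zeta> Z' Z g B] B o g by auto
    then show ?thesis
      using pull_cmp[of Z' B A Z g x \<zeta>] pull_zero[of x A B Z] o f g by simp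
  qed
  then show ?thesis using ext_trivial_iff o by blast
qed

text \<open>
  The dual, with \<open>\<bbbE>(M', A)\<close> in the role of \<open>\<bbbE>\<^sup>2(M, A)\<close>.
\<close>

lemma ext_cone:
  assumes c: "conflation C A x B y X" and z: "conflation C M' z P w M" and P: "projective C P"
    and A: "ext C M' A = {\<zero>\<^bsub>Ext C M' A\<^esub>}" and B: "ext C M B = {\<zero>\<^bsub>Ext C M B\<^esub>}"
  shows "ext C M X = {\<zero>\<^bsub>Ext C M X\<^esub>}"
proof -
  obtain \<delta> where d: "etriangle C A x B y X \<delta>" using c unfolding conflation_def by blast
  obtain \<pi> where t: "etriangle C M' z P w M \<pi>" using z unfolding conflation_def by blast
  note o = etriangleD[OF d] etriangleD[OF t]
  have "\<epsilon> = \<zero>\<^bsub>Ext C M X\<^esub>" if e: "\<epsilon> \<in> ext C M X" for \<epsilon>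
  proof -
    have "pull C w \<epsilon> = \<zero>\<^bsub>Ext C P X\<^esub>" using pull_ext[of \<epsilon> M X w P] ext_projective[OF P] o e by auto
    then obtain f where f: "f \<in> arr C M' X" "push C f \<pi> = \<epsilon>"
      using ext_in_image_of_connecting_push[OF t e] o by blast
    have "pull C f \<delta> = \<zero>\<^bsub>Ext C M' A\<^esub>" using pull_ext[of \<delta> X A f M'] A o f by auto
    then obtain g where g: "g \<in> arr C M' B" "y \<cdot>\<^bsub>C\<^esub> g = f"
      using factor_through_deflation[OF d f(1)] o by blast
    have "push C g \<pi> = \<zero>\<^bsub>Ext C M B\<^esub>" using push_ext[of \<pi> M M' g B] B o g by auto
    then show ?thesis
      using push_cmp[of M M' B X g y \<pi>] push_zero[of y B X M] o f g by simp
  qed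
  then show ?thesis using ext_trivial_iff o by blast
qed


section \<open>Cotorsion pairs as pairs of orthogonal classes\<close>

lemma left_perp_ext: "\<lbrakk>M \<in> left_perp C S; Z \<in> S\<rbrakk> \<Longrightarrow> ext C M Z = {\<zero>\<^bsub>Ext C M Z\<^esub>}"
  by (auto simp: left_perp_def)

lemma right_perp_ext: "\<lbrakk>N \<in> right_perp C S; Z \<in> S\<rbrakk> \<Longrightarrow> ext C Z N = {\<zero>\<^bsub>Ext C Z N\<^esub>}"
  by (auto simp: right_perp_def)

lemma left_perpI:
  "\<lbrakk>M \<in> obj C; \<And>Z. Z \<in> S \<Longrightarrow> ext C M Z = {\<zero>\<^bsub>Ext C M Z\<^esub>}\<rbrakk> \<Longrightarrow> M \<in> left_perp C S"
  unfolding left_perp_def by blast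

lemma right_perpI:
  "\<lbrakk>N \<in> obj C; \<And>Z. Z \<in> S \<Longrightarrow> ext C Z N = {\<zero>\<^bsub>Ext C Z N\<^esub>}\<rbrakk> \<Longrightarrow> N \<in> right_perp C S"
  unfolding right_perp_def by blast

lemma left_perp_extension:
  assumes "S \<subseteq> obj C" "conflation C A x B y X" "A \<in> left_perp C S" "X \<in> left_perp C S"
  shows "B \<in> left_perp C S"
proof (rule left_perpI)
  show "B \<in> obj C" using conflation_obj[OF assms(2)] by blast
  show "ext C B Z = {\<zero>\<^bsub>Ext C B Z\<^esub>}" if "Z \<in> S" for Z
    by (rule ext_middle_left[OF assms(2)])
      (use that assms(1) left_perp_ext[OF assms(3) that] left_perp_ext[OF assms(4) that] in blast)+
qed

lemma right_perp_extension:
  assumes "S \<subseteq> obj C" "conflation C A x B y X" "A \<in> right_perp C S" "X \<in> right_perp C S"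
  shows "B \<in> right_perp C S"
proof (rule right_perpI)
  show "B \<in> obj C" using conflation_obj[OF assms(2)] by blast
  show "ext C Z B = {\<zero>\<^bsub>Ext C Z B\<^esub>}" if "Z \<in> S" for Z
    by (rule ext_middle_right[OF assms(2)])
      (use that assms(1) right_perp_ext[OF assms(3) that] right_perp_ext[OF assms(4) that] in blast)+
qed

lemma left_perp_retract:
  assumes S: "S \<subseteq> obj C" and A: "A \<in> obj C" and B: "B \<in> left_perp C S"
    and a: "i \<in> arr C A B" "p \<in> arr C B A" "p \<cdot>\<^bsub>C\<^esub> i = ident C A"
  shows "A \<in> left_perp C S"
proof (rule left_perpI[OF A])
  have "B \<in> obj C" using B by (simp add: left_perp_def)
  then show "ext C A Z = {\<zero>\<^bsub>Ext C A Z\<^esub>}" if "Z \<in> S" for Z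
    using ext_retract_left[OF A _ _ left_perp_ext[OF B that] a] S that by blast
qed

lemma right_perp_retract:
  assumes S: "S \<subseteq> obj C" and A: "A \<in> obj C" and B: "B \<in> right_perp C S"
    and a: "i \<in> arr C A B" "p \<in> arr C B A" "p \<cdot>\<^bsub>C\<^esub> i = ident C A"
  shows "A \<in> right_perp C S"
proof (rule right_perpI[OF A])
  have "B \<in> obj C" using B by (simp add: right_perp_def)
  then show "ext C Z A = {\<zero>\<^bsub>Ext C Z A\<^esub>}" if "Z \<in> S" for Z
    using ext_retract_right[OF A _ _ right_perp_ext[OF B that] a] S that by blast
qed

lemma conflation_full_sub:
  "H \<subseteq> obj C \<Longrightarrow> conflation (full_sub C H) A x B y X \<longleftrightarrow>
    conflation C A x B y X \<and> A \<in> H \<and> B \<in> H \<and> X \<in> H"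
  by (auto simp: conflation_def etriangle_def full_sub_def)

lemma biproduct_full_sub:
  "H \<subseteq> obj C \<Longrightarrow> biproduct (full_sub C H) A A' S i i' p p' \<longleftrightarrow>
    biproduct C A A' S i i' p p' \<and> A \<in> H \<and> A' \<in> H \<and> S \<in> H"
  by (auto simp: biproduct_def full_sub_def)

lemma is_iso_full_sub: "is_iso (full_sub C H) = is_iso C"
  by (auto simp: is_iso_def full_sub_def fun_eq_iff)

text \<open>
  Given the approximations, closure under summands together with orthogonality amounts to each class
  being the full orthogonal of the other: an object of \<open>H\<close> orthogonal to \<open>T\<close> has a split approximation
  and so is a summand of an object of \<open>S\<close>. The right-hand side speaks of the ambient
  category only, so the exact sequences there apply to cotorsion pairs in \<open>H\<close>.
\<close>

lemma cotorsion_pair_full_sub_iff: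
  assumes H: "H \<subseteq> obj C"
  shows "cotorsion_pair (full_sub C H) S T \<longleftrightarrow>
    S = H \<inter> left_perp C T \<and> T = H \<inter> right_perp C S \<and>
    (\<forall>D\<in>H. (\<exists>Y\<in>T. \<exists>X\<in>S. \<exists>y x. conflation C Y y X x D) \<and>
           (\<exists>Y\<in>T. \<exists>X\<in>S. \<exists>y x. conflation C D y Y x X))"
    (is "?L \<longleftrightarrow> ?S \<and> ?T \<and> ?R")
proof (intro iffI conjI)
  assume L: ?L
  have sub: "S \<subseteq> H" "T \<subseteq> H"
    using L by (auto simp: cotorsion_pair_def subcategory_def full_sub_def)
  have orth: "ext C X Y = {\<zero>\<^bsub>Ext C X Y\<^esub>}" if "X \<in> S" "Y \<in> T" for X Y
    using L that by (auto simp: cotorsion_pair_def full_sub_def)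
  have app: "(\<exists>Y\<in>T. \<exists>X\<in>S. \<exists>y x. conflation C Y y X x D)"
    "(\<exists>Y\<in>T. \<exists>X\<in>S. \<exists>y x. conflation C D y Y x X)" if "D \<in> H" for D
  proof -
    have "D \<in> obj (full_sub C H)" using that by (simp add: full_sub_def)
    then have "(\<exists>Y\<in>T. \<exists>X\<in>S. \<exists>y x. conflation (full_sub C H) Y y X x D) \<and>
      (\<exists>Y\<in>T. \<exists>X\<in>S. \<exists>y x. conflation (full_sub C H) D y Y x X)"
      using L unfolding cotorsion_pair_def by blast
    then show "(\<exists>Y\<in>T. \<exists>X\<in>S. \<exists>y x. conflation C Y y X x D)"
      "(\<exists>Y\<in>T. \<exists>X\<in>S. \<exists>y x. conflation C D y Y x X)"
      using conflation_full_sub[OF H] by blast+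
  qed
  then show ?R by blast
  have summand: "A \<in> S'" if "S' = S \<or> S' = T" "biproduct C A A' Z i i' p p'" "Z \<in> S'" "A' \<in> H" "A \<in> H"
    for A A' Z i i' p p' S'
  proof -
    have "closed_under_summands (full_sub C H) S'" using L that(1) by (auto simp: cotorsion_pair_def)
    moreover have "biproduct (full_sub C H) A A' Z i i' p p'"
      using biproduct_full_sub[OF H] that sub by blast
    ultimately show ?thesis using that(3) unfolding closed_under_summands_def by blast
  qed
  show ?S
  proof
    show "S \<subseteq> H \<inter> left_perp C T" using sub orth H left_perpI[of _ T] by blast
    show "H \<inter> left_perp C T \<subseteq> S"
    proof
      fix M assume M: "M \<in> H \<inter> left_perp C T"
      then obtain Y X y x where c: "Y \<in> T" "X \<in> S" "conflation C Y y X x M" using app by blast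
      then obtain s r where "biproduct C Y M X y s r x"
        using conflation_splits left_perp_ext M by blast
      then show "M \<in> S" using summand[of S M Y X] biproduct_sym c sub M by blast
    qed
  qed
  show ?T
  proof
    show "T \<subseteq> H \<inter> right_perp C S" using sub orth H right_perpI[of _ S] by blast
    show "H \<inter> right_perp C S \<subseteq> T"
    proof
      fix N assume N: "N \<in> H \<inter> right_perp C S"
      then obtain Y X y x where c: "Y \<in> T" "X \<in> S" "conflation C N y Y x X" using app by blast
      then obtain s r where "biproduct C N X Y y s r x"
        using conflation_splits right_perp_ext N by blast
      then show "N \<in> T" using summand[of T N X Y] c sub N by blast
    qed
  qed
next
  assume R: "?S \<and> ?T \<and> ?R"
  then have RS: ?S and RT: ?T by blast+
  have sub: "S \<subseteq> H" "T \<subseteq> H" using equalityD1[OF RS] equalityD1[OF RT] by blast+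
  have So: "S \<subseteq> obj C" and To: "T \<subseteq> obj C" using sub H by auto
  have retS: "A \<in> S"
    if "Z \<in> S" "A \<in> H" "i \<in> arr C A Z" "p \<in> arr C Z A" "p \<cdot>\<^bsub>C\<^esub> i = ident C A" for A Z i p
  proof -
    have "A \<in> left_perp C T" using left_perp_retract[OF To _ _ that(3-5)] R that(1,2) H by blast
    then show ?thesis using R that(2) by blast
  qed
  have retT: "A \<in> T"
    if "Z \<in> T" "A \<in> H" "i \<in> arr C A Z" "p \<in> arr C Z A" "p \<cdot>\<^bsub>C\<^esub> i = ident C A" for A Z i p
  proof -
    have "A \<in> right_perp C S" using right_perp_retract[OF So _ _ that(3-5)] R that(1,2) H by blast
    then show ?thesis using R that(2) by blast
  qed
  have iso: "\<exists>i p. i \<in> arr C A Z \<and> p \<in> arr C Z A \<and> p \<cdot>\<^bsub>C\<^esub> i = ident C A"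
    if "is_iso C Z A f" for A Z f
    using that by (auto simp: is_iso_def)
  have bip: "i \<in> arr C A Z \<and> p \<in> arr C Z A \<and> p \<cdot>\<^bsub>C\<^esub> i = ident C A \<and> A \<in> H"
    if "biproduct (full_sub C H) A A' Z i i' p p'" for A A' Z i i' p p'
    using that by (auto simp: biproduct_def full_sub_def)
  have "subcategory (full_sub C H) S" "subcategory (full_sub C H) T"
    using sub retS retT iso unfolding subcategory_def is_iso_full_sub
    by (simp add: full_sub_def, meson)+
  moreover have "closed_under_summands (full_sub C H) S" "closed_under_summands (full_sub C H) T"
    using bip retS retT unfolding closed_under_summands_def by meson+
  moreover have "\<forall>X\<in>S. \<forall>Y\<in>T. ext (full_sub C H) X Y = {\<zero>\<^bsub>Ext (full_sub C H) X Y\<^esub>}"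
  proof (intro ballI)
    fix X Y assume "X \<in> S" "Y \<in> T"
    then have "ext C X Y = {\<zero>\<^bsub>Ext C X Y\<^esub>}" using R left_perp_ext[of X T Y] by blast
    then show "ext (full_sub C H) X Y = {\<zero>\<^bsub>Ext (full_sub C H) X Y\<^esub>}" by (simp add: full_sub_def)
  qed
  moreover have "\<forall>D\<in>obj (full_sub C H).
      (\<exists>Y\<in>T. \<exists>X\<in>S. \<exists>y x. conflation (full_sub C H) Y y X x D) \<and>
      (\<exists>Y\<in>T. \<exists>X\<in>S. \<exists>y x. conflation (full_sub C H) D y Y x X)"
  proof
    fix D assume "D \<in> obj (full_sub C H)"
    then have "D \<in> H" by (simp add: full_sub_def)
    then show "(\<exists>Y\<in>T. \<exists>X\<in>S. \<exists>y x. conflation (full_sub C H) Y y X x D) \<and>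
      (\<exists>Y\<in>T. \<exists>X\<in>S. \<exists>y x. conflation (full_sub C H) D y Y x X)"
      using R sub unfolding conflation_full_sub[OF H] by (meson subsetD)
  qed
  ultimately show ?L unfolding cotorsion_pair_def by blast
qed

lemma cotorsion_pair_iff:
  "cotorsion_pair C S T \<longleftrightarrow> S = left_perp C T \<and> T = right_perp C S \<and>
    (\<forall>D\<in>obj C. (\<exists>Y\<in>T. \<exists>X\<in>S. \<exists>y x. conflation C Y y X x D) \<and>
               (\<exists>Y\<in>T. \<exists>X\<in>S. \<exists>y x. conflation C D y Y x X))"
proof -
  have "conflation (full_sub C (obj C)) = conflation C"
    using conflation_obj conflation_full_sub[of "obj C"] by (auto simp: fun_eq_iff)
  moreover have "biproduct (full_sub C (obj C)) = biproduct C"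
    by (auto simp: biproduct_def full_sub_def fun_eq_iff)
  ultimately have "cotorsion_pair (full_sub C (obj C)) S T = cotorsion_pair C S T"
    unfolding cotorsion_pair_def subcategory_def closed_under_summands_def is_iso_full_sub
    by (simp add: full_sub_def)
  moreover have "obj C \<inter> left_perp C T = left_perp C T" "obj C \<inter> right_perp C S = right_perp C S"
    by (auto simp: left_perp_def right_perp_def)
  ultimately show ?thesis using cotorsion_pair_full_sub_iff[of "obj C" S T] by simp
qed

lemma cotorsion_pair_obj: "cotorsion_pair C S T \<Longrightarrow> S \<subseteq> obj C \<and> T \<subseteq> obj C"
  by (auto simp: cotorsion_pair_def subcategory_def)

lemma cotorsion_pair_left: "cotorsion_pair C S T \<Longrightarrow> S = left_perp C T"
  and cotorsion_pair_right: "cotorsion_pair C S T \<Longrightarrow> T = right_perp C S"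
  and cotorsion_pair_precover: "\<lbrakk>cotorsion_pair C S T; D \<in> obj C\<rbrakk> \<Longrightarrow> \<exists>Y\<in>T. \<exists>X\<in>S. \<exists>y x. conflation C Y y X x D"
  and cotorsion_pair_preenvelope: "\<lbrakk>cotorsion_pair C S T; D \<in> obj C\<rbrakk> \<Longrightarrow> \<exists>Y\<in>T. \<exists>X\<in>S. \<exists>y x. conflation C D y Y x X"
  unfolding cotorsion_pair_iff by blast+

lemma cotorsion_pair_ext:
  "\<lbrakk>cotorsion_pair C S T; X \<in> S; Y \<in> T\<rbrakk> \<Longrightarrow> ext C X Y = {\<zero>\<^bsub>Ext C X Y\<^esub>}"
  by (auto simp: cotorsion_pair_def)

lemma cotorsion_pair_left_extension:
  assumes "cotorsion_pair C S T" "conflation C A x B y X" "A \<in> S" "X \<in> S"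
  shows "B \<in> S"
  using left_perp_extension[of T, OF _ assms(2)] cotorsion_pair_left[OF assms(1)]
    cotorsion_pair_obj[OF assms(1)] assms(3,4) by blast

lemma cotorsion_pair_right_extension:
  assumes "cotorsion_pair C S T" "conflation C A x B y X" "A \<in> T" "X \<in> T"
  shows "B \<in> T"
  using right_perp_extension[of S, OF _ assms(2)] cotorsion_pair_right[OF assms(1)]
    cotorsion_pair_obj[OF assms(1)] assms(3,4) by blast

lemma injectives_subset: "cotorsion_pair C S T \<Longrightarrow> injectives C \<subseteq> T"
proof
  fix I assume p: "cotorsion_pair C S T" and "I \<in> injectives C"
  then have I: "injective C I" by simp
  have "I \<in> right_perp C S"
    using ext_injective[OF I] cotorsion_pair_obj[OF p] I
    by (intro right_perpI) (auto simp only: injective_def)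
  then show "I \<in> T" using cotorsion_pair_right[OF p] by blast
qed

section \<open>Hereditary cotorsion pairs\<close>

lemma hereditary_cotorsion: "hereditary_cotorsion_pair C S T \<Longrightarrow> cotorsion_pair C S T"
  by (simp add: hereditary_cotorsion_pair_def)

text \<open>
  A syzygy of \<open>M\<close> is again in \<open>S\<close>, which gives \<open>\<bbbE>\<^sup>2(M, A) = 0\<close>.
\<close>

lemma hereditary_ext_cone:
  assumes h: "hereditary_cotorsion_pair C S T" and ep: "enough_projectives C"
    and c: "conflation C A x B y X" and "A \<in> T" "M \<in> S" and B: "ext C M B = {\<zero>\<^bsub>Ext C M B\<^esub>}"
  shows "ext C M X = {\<zero>\<^bsub>Ext C M X\<^esub>}"
proof -
  have "M \<in> obj C" using cotorsion_pair_obj[OF hereditary_cotorsion[OF h]] \<open>M \<in> S\<close> by blast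
  then obtain M' z P w where z: "projective C P" "conflation C M' z P w M"
    using ep unfolding enough_projectives_def by blast
  then have "M' \<in> Omega C S" using \<open>M \<in> S\<close> by (auto simp: Omega_def CoCone_def)
  then have "M' \<in> S" using h by (auto simp: hereditary_cotorsion_pair_def)
  then show ?thesis
    using ext_cone[OF c z(2,1)] cotorsion_pair_ext[OF hereditary_cotorsion[OF h]] \<open>A \<in> T\<close> B by blast
qed

lemma hereditary_cone_closed:
  assumes h: "hereditary_cotorsion_pair C S T" and ep: "enough_projectives C"
    and c: "conflation C A x B y X" and "A \<in> T" "B \<in> T"
  shows "X \<in> T"
proof -
  note p = hereditary_cotorsion[OF h]
  have "X \<in> right_perp C S"
    using hereditary_ext_cone[OF h ep c \<open>A \<in> T\<close>] cotorsion_pair_ext[OF p _ \<open>B \<in> T\<close>]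
      conflation_obj[OF c] by (intro right_perpI) blast+
  then show ?thesis using cotorsion_pair_right[OF p] by blast
qed

lemma hereditary_Cone_injectives:
  assumes h: "hereditary_cotorsion_pair C S T" and ep: "enough_projectives C"
  shows "Cone C T (injectives C) \<subseteq> T"
  using hereditary_cone_closed[OF h ep] injectives_subset[OF hereditary_cotorsion[OF h]]
  by (auto simp: Cone_def)

text \<open>
  Two classes \<open>T\<close>, \<open>T'\<close> are kept apart because the case \<open>T = \<Sigma>\<^sup>nV\<close>, \<open>T' = \<Sigma>\<^sup>n\<^sup>+\<^sup>1V\<close> computes the iterated cones,
  while \<open>T = T'\<close> gives the heredity statements.
\<close>

lemma ext_cocone_of_Cone_injectives:
  assumes T: "Cone C T (injectives C) \<subseteq> T'" and ei: "enough_injectives C"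
    and c: "conflation C A x B y X" and X: "X \<in> left_perp C T'" and Z: "Z \<in> T" "Z \<in> obj C"
    and B: "ext C B Z = {\<zero>\<^bsub>Ext C B Z\<^esub>}"
  shows "ext C A Z = {\<zero>\<^bsub>Ext C A Z\<^esub>}"
proof -
  obtain z I w Z' where z: "injective C I" "conflation C Z z I w Z'"
    using ei Z(2) unfolding enough_injectives_def by blast
  then have "Z' \<in> Cone C T (injectives C)" using Z(1) unfolding Cone_def by blast
  then have "Z' \<in> T'" using T by blast
  then show ?thesis using ext_cocone[OF c z(2,1)] left_perp_ext X B by blast
qed

lemma hereditary_ext_cocone:
  assumes h: "hereditary_cotorsion_pair C S T" and ep: "enough_projectives C"
    and ei: "enough_injectives C"
    and c: "conflation C A x B y X" and "X \<in> S" "Z \<in> T" and B: "ext C B Z = {\<zero>\<^bsub>Ext C B Z\<^esub>}"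
  shows "ext C A Z = {\<zero>\<^bsub>Ext C A Z\<^esub>}"
  using ext_cocone_of_Cone_injectives[OF hereditary_Cone_injectives[OF h ep] ei c _ _ _ B]
    cotorsion_pair_left[OF hereditary_cotorsion[OF h]] cotorsion_pair_obj[OF hereditary_cotorsion[OF h]]
    \<open>X \<in> S\<close> \<open>Z \<in> T\<close> by blast

lemma hereditary_cocone_closed:
  assumes h: "hereditary_cotorsion_pair C S T" and ep: "enough_projectives C"
    and ei: "enough_injectives C"
    and c: "conflation C A x B y X" and "B \<in> S" "X \<in> S"
  shows "A \<in> S"
proof -
  note p = hereditary_cotorsion[OF h]
  have "A \<in> left_perp C T"
    using hereditary_ext_cocone[OF h ep ei c \<open>X \<in> S\<close>] cotorsion_pair_ext[OF p \<open>B \<in> S\<close>]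
      conflation_obj[OF c] by (intro left_perpI) blast+
  then show ?thesis using cotorsion_pair_left[OF p] by blast
qed

text \<open>
  Heredity may be tested on cosyzygies of the right class. This form applies to \<open>\<Sigma>\<^sup>iV\<close>, where syzygies of
  the left class are not directly accessible.
\<close>

lemma hereditary_if_Cone_injectives:
  assumes p: "cotorsion_pair C S T" and ei: "enough_injectives C" and T: "Cone C T (injectives C) \<subseteq> T"
  shows "hereditary_cotorsion_pair C S T"
proof -
  have "A \<in> S" if "A \<in> Omega C S" for A
  proof -
    obtain P M x y where c: "projective C P" "M \<in> S" "conflation C A x P y M"
      using \<open>A \<in> Omega C S\<close> by (auto simp: Omega_def CoCone_def)
    have M: "M \<in> left_perp C T" using c(2) cotorsion_pair_left[OF p] by blast
    have "A \<in> left_perp C T"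
    proof (rule left_perpI)
      show "A \<in> obj C" using conflation_obj[OF c(3)] by blast
      fix Z assume Z: "Z \<in> T"
      then have "Z \<in> obj C" using cotorsion_pair_obj[OF p] by blast
      then show "ext C A Z = {\<zero>\<^bsub>Ext C A Z\<^esub>}"
        using ext_cocone_of_Cone_injectives[OF T ei c(3) M Z] ext_projective[OF c(1)] by blast
    qed
    then show ?thesis using cotorsion_pair_left[OF p] by blast
  qed
  then show ?thesis using p by (auto simp: hereditary_cotorsion_pair_def)
qed

end

section \<open>Intervals of cotorsion pairs\<close>

locale cotorsion_interval = extriangulated_category K C
  for K :: "('k, 'r) ring_scheme" (structure)
    and C :: "('k, 'o, 'm, 'e, 'z) ext_cat_scheme" +
  fixes U V U\<^sub>1 V\<^sub>1 :: "'o set"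
  assumes enough_proj: "enough_projectives C" and enough_inj: "enough_injectives C"
    and UV_hereditary: "hereditary_cotorsion_pair C U V" and U1V1_hereditary: "hereditary_cotorsion_pair C U\<^sub>1 V\<^sub>1"
    and V1_V: "V\<^sub>1 \<subseteq> V"
begin

abbreviation heart :: "'o set" where "heart \<equiv> V \<inter> U\<^sub>1"

lemmas UV = hereditary_cotorsion[OF UV_hereditary]
  and U1V1 = hereditary_cotorsion[OF U1V1_hereditary]

lemma U_U1: "U \<subseteq> U\<^sub>1"
  using left_perp_antimono[OF V1_V] cotorsion_pair_left[OF UV] cotorsion_pair_left[OF U1V1] by simp

lemma heart_obj: "heart \<subseteq> obj C"
  using cotorsion_pair_obj[OF UV] by blast

definition restrict_pair :: "'o set \<times> 'o set \<Rightarrow> 'o set \<times> 'o set" where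
  "restrict_pair = (\<lambda>(U', V'). (U' \<inter> V, V' \<inter> U\<^sub>1))"

definition extend_pair :: "'o set \<times> 'o set \<Rightarrow> 'o set \<times> 'o set" where
  "extend_pair = (\<lambda>(X, Y). (U\<^sub>1 \<inter> left_perp C Y, V \<inter> right_perp C X))"

context
  fixes U' V'
  assumes UV': "cotorsion_pair C U' V'" and lower: "U \<subseteq> U'" and upper: "U' \<subseteq> U\<^sub>1"
begin

lemma V'_V: "V' \<subseteq> V"
  using right_perp_antimono[OF lower] cotorsion_pair_right[OF UV] cotorsion_pair_right[OF UV'] by simp

text \<open>
  For \<open>M\<close> in the left-hand side take \<open>Y \<rightarrow> X \<rightarrow> M\<close> with \<open>Y \<in> V'\<close>, \<open>X \<in> U'\<close>. Closure of \<open>U\<^sub>1\<close> under cocones puts \<open>Y\<close>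
  into \<open>V' \<inter> U\<^sub>1\<close>, so the conflation splits.
\<close>

lemma U'_from_restriction: "U\<^sub>1 \<inter> left_perp C (V' \<inter> U\<^sub>1) = U'"
proof
  show "U' \<subseteq> U\<^sub>1 \<inter> left_perp C (V' \<inter> U\<^sub>1)"
    using upper cotorsion_pair_left[OF UV'] left_perp_antimono[of "V' \<inter> U\<^sub>1" V'] by auto
  show "U\<^sub>1 \<inter> left_perp C (V' \<inter> U\<^sub>1) \<subseteq> U'"
  proof
    fix M assume M: "M \<in> U\<^sub>1 \<inter> left_perp C (V' \<inter> U\<^sub>1)"
    then have Mo: "M \<in> obj C" by (auto simp: left_perp_def)
    then obtain Y X y x where c: "Y \<in> V'" "X \<in> U'" "conflation C Y y X x M"
      using cotorsion_pair_precover[OF UV'] by blast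
    have "Y \<in> U\<^sub>1" using hereditary_cocone_closed[OF U1V1_hereditary enough_proj enough_inj c(3)] c(2) upper M by blast
    then obtain s r where "biproduct C Y M X y s r x"
      using conflation_splits[OF c(3)] left_perp_ext M c(1) by blast
    from biproduct_sym[OF this] show "M \<in> U'"
      using UV' c(2) unfolding cotorsion_pair_def closed_under_summands_def by blast
  qed
qed

text \<open>
  Dually, through closure of \<open>V\<close> under cones.
\<close>

lemma V'_from_restriction: "V \<inter> right_perp C (U' \<inter> V) = V'"
proof
  show "V' \<subseteq> V \<inter> right_perp C (U' \<inter> V)"
    using V'_V cotorsion_pair_right[OF UV'] right_perp_antimono[of "U' \<inter> V" U'] by auto
  show "V \<inter> right_perp C (U' \<inter> V) \<subseteq> V'"
  proof
    fix N assume N: "N \<in> V \<inter> right_perp C (U' \<inter> V)"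
    then have No: "N \<in> obj C" by (auto simp: right_perp_def)
    then obtain Y X y x where c: "Y \<in> V'" "X \<in> U'" "conflation C N y Y x X"
      using cotorsion_pair_preenvelope[OF UV'] by blast
    have "X \<in> V" using hereditary_cone_closed[OF UV_hereditary enough_proj c(3)] c(1) V'_V N by blast
    then obtain s r where "biproduct C N X Y y s r x"
      using conflation_splits[OF c(3)] right_perp_ext N c(2) by blast
    then show "N \<in> V'"
      using UV' c(1) unfolding cotorsion_pair_def closed_under_summands_def by blast
  qed
qed

lemma restriction_is_cotorsion_pair: "cotorsion_pair (full_sub C heart) (U' \<inter> V) (V' \<inter> U\<^sub>1)"
proof -
  have 1: "U' \<inter> V = heart \<inter> left_perp C (V' \<inter> U\<^sub>1)" using U'_from_restriction by blast
  have 2: "V' \<inter> U\<^sub>1 = heart \<inter> right_perp C (U' \<inter> V)" using V'_from_restriction by blast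
  have 3: "(\<exists>Y\<in>V' \<inter> U\<^sub>1. \<exists>X\<in>U' \<inter> V. \<exists>y x. conflation C Y y X x D)" if D: "D \<in> heart" for D
  proof -
    obtain Y X y x where c: "Y \<in> V'" "X \<in> U'" "conflation C Y y X x D"
      using cotorsion_pair_precover[OF UV'] D heart_obj by blast
    have "Y \<in> U\<^sub>1" using hereditary_cocone_closed[OF U1V1_hereditary enough_proj enough_inj c(3)] c(2) upper D by blast
    moreover have "X \<in> V" using cotorsion_pair_right_extension[OF UV c(3)] c(1) V'_V D by blast
    ultimately show ?thesis using c by blast
  qed
  have 4: "(\<exists>Y\<in>V' \<inter> U\<^sub>1. \<exists>X\<in>U' \<inter> V. \<exists>y x. conflation C D y Y x X)" if D: "D \<in> heart" for D
  proof -
    obtain Y X y x where c: "Y \<in> V'" "X \<in> U'" "conflation C D y Y x X"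
      using cotorsion_pair_preenvelope[OF UV'] D heart_obj by blast
    have "X \<in> V" using hereditary_cone_closed[OF UV_hereditary enough_proj c(3)] c(1) V'_V D by blast
    moreover have "Y \<in> U\<^sub>1" using cotorsion_pair_left_extension[OF U1V1 c(3)] c(2) upper D by blast
    ultimately show ?thesis using c by blast
  qed
  show ?thesis using cotorsion_pair_full_sub_iff[OF heart_obj, of "U' \<inter> V" "V' \<inter> U\<^sub>1"] 1 2 3 4 by blast
qed

end

context
  fixes X Y
  assumes q: "cotorsion_pair (full_sub C heart) X Y"
begin

lemma X_eq: "X = heart \<inter> left_perp C Y"
  and Y_eq: "Y = heart \<inter> right_perp C X"
  and heart_precover: "D \<in> heart \<Longrightarrow> \<exists>N\<in>Y. \<exists>M\<in>X. \<exists>y x. conflation C N y M x D"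
  and heart_preenvelope: "D \<in> heart \<Longrightarrow> \<exists>N\<in>Y. \<exists>M\<in>X. \<exists>y x. conflation C D y N x M"
  using q unfolding cotorsion_pair_full_sub_iff[OF heart_obj] by blast+

lemma X_heart: "X \<subseteq> heart" and Y_heart: "Y \<subseteq> heart"
  using X_eq Y_eq by blast+

lemma X_Y_ext: "\<lbrakk>M \<in> X; N \<in> Y\<rbrakk> \<Longrightarrow> ext C M N = {\<zero>\<^bsub>Ext C M N\<^esub>}"
  using X_eq left_perp_ext by blast

abbreviation "U' \<equiv> U\<^sub>1 \<inter> left_perp C Y"
abbreviation "V' \<equiv> V \<inter> right_perp C X"

lemma U_sub_U': "U \<subseteq> U'"
  using U_U1 cotorsion_pair_left[OF UV] left_perp_antimono[of Y V] Y_heart by blast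

lemma X_sub_U': "X \<subseteq> U'"
  using X_eq by blast

lemma Y_sub_V': "Y \<subseteq> V'"
  using Y_eq by blast

lemma V1_sub_V': "V\<^sub>1 \<subseteq> V'"
  using V1_V cotorsion_pair_right[OF U1V1] right_perp_antimono[of X U\<^sub>1] X_heart by blast

text \<open>
  The middle term of the \<open>V\<close>-approximation of \<open>A\<close> is an extension of objects of \<open>U\<^sub>1 \<inter> \<^sup>\<bottom>Y\<close>, hence lies in
  \<open>V \<inter> U\<^sub>1 \<inter> \<^sup>\<bottom>Y = X\<close>.
\<close>

lemma U'_copresentation:
  assumes A: "A \<in> U'"
  shows "\<exists>M\<in>X. \<exists>P\<in>U. \<exists>x y. conflation C A x M y P"
proof -
  have "A \<in> obj C" using A unfolding left_perp_def by blast
  then obtain M P x y where c: "M \<in> V" "P \<in> U" "conflation C A x M y P"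
    using cotorsion_pair_preenvelope[OF UV] by blast
  have "M \<in> U\<^sub>1" using cotorsion_pair_left_extension[OF U1V1 c(3)] c(2) U_U1 A by blast
  moreover have "M \<in> left_perp C Y"
    using left_perp_extension[OF _ c(3)] A U_sub_U' c(2) Y_heart heart_obj by blast
  ultimately show ?thesis using X_eq c by blast
qed

lemma U'_V'_ext:
  assumes A: "A \<in> U'" and B: "B \<in> V'"
  shows "ext C A B = {\<zero>\<^bsub>Ext C A B\<^esub>}"
proof -
  obtain M P x y where c: "M \<in> X" "P \<in> U" "conflation C A x M y P"
    using U'_copresentation[OF A] by blast
  then show ?thesis
    using hereditary_ext_cocone[OF UV_hereditary enough_proj enough_inj c(3)] right_perp_ext B by blast
qed

text \<open>
  The inclusions opposite to orthogonality hold because \<open>V\<^sub>1\<close> and \<open>Y\<close> lie in \<open>V'\<close>, and \<open>U\<close> and \<open>X\<close> lie in \<open>U'\<close>.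
\<close>

lemma U'_V'_perp: "U' = left_perp C V'" "V' = right_perp C U'"
proof -
  have o: "U' \<subseteq> obj C" "V' \<subseteq> obj C" by (auto simp: left_perp_def right_perp_def)
  have "left_perp C V' \<subseteq> U'"
    using left_perp_antimono[OF V1_sub_V'] left_perp_antimono[OF Y_sub_V'] cotorsion_pair_left[OF U1V1]
    by blast
  moreover have "U' \<subseteq> left_perp C V'" using U'_V'_ext o unfolding left_perp_def[of C V'] by blast
  ultimately show "U' = left_perp C V'" by blast
  have "right_perp C U' \<subseteq> V'"
    using right_perp_antimono[OF U_sub_U'] right_perp_antimono[OF X_sub_U'] cotorsion_pair_right[OF UV]
    by blast
  moreover have "V' \<subseteq> right_perp C U'" using U'_V'_ext o unfolding right_perp_def[of C U'] by blast
  ultimately show "V' = right_perp C U'" by blast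
qed

lemma U'_extension: "\<lbrakk>conflation C A x B y D; A \<in> U'; D \<in> U'\<rbrakk> \<Longrightarrow> B \<in> U'"
  using left_perp_extension[of V'] U'_V'_perp(1) cotorsion_pair_obj[OF UV] by blast

lemma V'_extension: "\<lbrakk>conflation C A x B y D; A \<in> V'; D \<in> V'\<rbrakk> \<Longrightarrow> B \<in> V'"
  using right_perp_extension[of U'] U'_V'_perp(2) cotorsion_pair_obj[OF U1V1] by blast

text \<open>
  Replace \<open>D\<close> by \<open>N \<in> V\<close> at the cost of \<open>P \<in> U\<close>, cover \<open>N\<close> by an object \<open>G\<close> of the heart with cocone
  \<open>L \<in> V\<^sub>1\<close>, and embed \<open>G\<close> into \<open>Y0 \<in> Y\<close> with cone \<open>X0 \<in> X\<close>. For \<open>E\<close> glued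
  from \<open>N\<close> and \<open>Y0\<close> along \<open>G\<close>, the conflation \<open>N \<rightarrow> E \<rightarrow> X0\<close> shows \<open>E \<in> V\<close> and \<open>L \<rightarrow> Y0 \<rightarrow> E\<close> shows that \<open>E\<close> is
  right orthogonal to \<open>X\<close>. The cone of \<open>D \<rightarrow> N \<rightarrow> E\<close> is an extension of \<open>X0\<close> by \<open>P\<close>.
\<close>

lemma U'_V'_preenvelope:
  assumes D: "D \<in> obj C"
  shows "\<exists>B\<in>V'. \<exists>A\<in>U'. \<exists>y x. conflation C D y B x A"
proof -
  obtain N P n m where c: "N \<in> V" "P \<in> U" "conflation C D n N m P"
    using cotorsion_pair_preenvelope[OF UV D] by blast
  obtain L G l g where g: "L \<in> V\<^sub>1" "G \<in> U\<^sub>1" "conflation C L l G g N"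
    using cotorsion_pair_precover[OF U1V1 conflation_obj(2)[OF c(3)]] by blast
  have "G \<in> V" using cotorsion_pair_right_extension[OF UV g(3)] g(1) V1_V c(1) by blast
  then obtain Y0 X0 u v where e: "Y0 \<in> Y" "X0 \<in> X" "conflation C G u Y0 v X0"
    using heart_preenvelope g(2) by blast
  obtain E w d f where E: "conflation C L (u \<cdot>\<^bsub>C\<^esub> l) Y0 w E" "conflation C N d E f X0"
    using et4 g(3) e(3) unfolding conflation_def by meson
  have "E \<in> V" using cotorsion_pair_right_extension[OF UV E(2)] c(1) e(2) X_heart by blast
  moreover have "E \<in> right_perp C X"
  proof -
    have "ext C M E = {\<zero>\<^bsub>Ext C M E\<^esub>}" if "M \<in> X" for M
      using hereditary_ext_cone[OF U1V1_hereditary enough_proj E(1) g(1)] X_Y_ext[OF that e(1)] that X_heart by blast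
    then show ?thesis using conflation_obj[OF E(1)] by (intro right_perpI) blast+
  qed
  ultimately have EV: "E \<in> V'" by blast
  obtain F a b r s where F: "conflation C D a E b F" "conflation C P r F s X0"
    using et4 c(3) E(2) unfolding conflation_def by meson
  have "F \<in> U'" using U'_extension[OF F(2)] c(2) U_sub_U' e(2) X_sub_U' by blast
  then show ?thesis using F(1) EV by blast
qed

text \<open>
  Dually, with \<open>E\<close> glued from \<open>X0\<close> and \<open>M\<close> over \<open>G\<close>; the cocone of \<open>E \<rightarrow> M \<rightarrow> D\<close> is an extension of
  \<open>L \<in> V\<^sub>1\<close> by \<open>Y0 \<in> Y\<close>.
\<close>

lemma U'_V'_precover:
  assumes D: "D \<in> obj C"
  shows "\<exists>B\<in>V'. \<exists>A\<in>U'. \<exists>y x. conflation C B y A x D"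
proof -
  obtain L M l m where c: "L \<in> V\<^sub>1" "M \<in> U\<^sub>1" "conflation C L l M m D"
    using cotorsion_pair_precover[OF U1V1 D] by blast
  obtain G P g w where g: "G \<in> V" "P \<in> U" "conflation C M g G w P"
    using cotorsion_pair_preenvelope[OF UV conflation_obj(2)[OF c(3)]] by blast
  have "G \<in> U\<^sub>1" using cotorsion_pair_left_extension[OF U1V1 g(3)] g(2) U_U1 c(2) by blast
  then obtain Y0 X0 u v where e: "Y0 \<in> Y" "X0 \<in> X" "conflation C Y0 u X0 v G"
    using heart_precover g(1) by blast
  obtain E n d f where E: "conflation C E n X0 (w \<cdot>\<^bsub>C\<^esub> v) P" "conflation C Y0 d E f M"
    using et4_op e(3) g(3) unfolding conflation_def by meson
  have "E \<in> U\<^sub>1" using cotorsion_pair_left_extension[OF U1V1 E(2)] c(2) e(1) Y_heart by blast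
  moreover have "E \<in> left_perp C Y"
  proof -
    have "ext C E N = {\<zero>\<^bsub>Ext C E N\<^esub>}" if "N \<in> Y" for N
      using hereditary_ext_cocone[OF UV_hereditary enough_proj enough_inj E(1) g(2)] X_Y_ext[OF e(2) that] that Y_heart by blast
    then show ?thesis using conflation_obj[OF E(1)] by (intro left_perpI) blast+
  qed
  ultimately have EU: "E \<in> U'" by blast
  obtain F a b r s where F: "conflation C F a E b D" "conflation C Y0 r F s L"
    using et4_op E(2) c(3) unfolding conflation_def by meson
  have "F \<in> V'" using V'_extension[OF F(2)] c(1) V1_sub_V' e(1) Y_sub_V' by blast
  then show ?thesis using F(1) EU by blast
qed

lemma extension_is_cotorsion_pair: "cotorsion_pair C U' V'"
  unfolding cotorsion_pair_iff[of U' V'] using U'_V'_perp U'_V'_preenvelope U'_V'_precover by blast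

lemma restriction_of_extension: "U' \<inter> V = X" "V' \<inter> U\<^sub>1 = Y"
  using X_eq Y_eq by blast+

end

theorem interval_bijection:
  "bij_betw restrict_pair
    {(U', V'). cotorsion_pair C U' V' \<and> U \<subseteq> U' \<and> U' \<subseteq> U\<^sub>1}
    {(X, Y). cotorsion_pair (full_sub C heart) X Y}"
proof (rule bij_betw_byWitness[where f' = extend_pair])
  show "\<forall>a\<in>{(U', V'). cotorsion_pair C U' V' \<and> U \<subseteq> U' \<and> U' \<subseteq> U\<^sub>1}. extend_pair (restrict_pair a) = a"
    using U'_from_restriction V'_from_restriction by (auto simp: restrict_pair_def extend_pair_def)
  show "\<forall>a\<in>{(X, Y). cotorsion_pair (full_sub C heart) X Y}. restrict_pair (extend_pair a) = a"
    using restriction_of_extension by (auto simp: restrict_pair_def extend_pair_def)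
  show "restrict_pair ` {(U', V'). cotorsion_pair C U' V' \<and> U \<subseteq> U' \<and> U' \<subseteq> U\<^sub>1}
      \<subseteq> {(X, Y). cotorsion_pair (full_sub C heart) X Y}"
    using restriction_is_cotorsion_pair by (auto simp: restrict_pair_def)
  show "extend_pair ` {(X, Y). cotorsion_pair (full_sub C heart) X Y}
      \<subseteq> {(U', V'). cotorsion_pair C U' V' \<and> U \<subseteq> U' \<and> U' \<subseteq> U\<^sub>1}"
  proof
    fix a assume "a \<in> extend_pair ` {(X, Y). cotorsion_pair (full_sub C heart) X Y}"
    then obtain X Y where q: "cotorsion_pair (full_sub C heart) X Y" and a: "a = extend_pair (X, Y)"
      by blast
    show "a \<in> {(U', V'). cotorsion_pair C U' V' \<and> U \<subseteq> U' \<and> U' \<subseteq> U\<^sub>1}"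
      using extension_is_cotorsion_pair[OF q] U_sub_U'[OF q] by (simp add: a extend_pair_def)
  qed
qed

end

section \<open>Iterated cones of the core\<close>

context extriangulated_category
begin

lemma Cone_mono: "S \<subseteq> S' \<Longrightarrow> Cone C S T \<subseteq> Cone C S' T"
  by (auto simp: Cone_def)

lemma Sigma_pow_Suc: "Sigma_pow C (Suc n) S = Cone C (Sigma_pow C n S) (injectives C)"
  by (simp add: Sigma_pow_def)

lemma Sigma_pow_Suc_subset:
  assumes "Cone C S (injectives C) \<subseteq> S"
  shows "Sigma_pow C (Suc n) S \<subseteq> Sigma_pow C n S"
proof (induction n)
  case 0
  then show ?case using assms by (simp add: Sigma_pow_def)
next
  case (Suc n)
  then show ?case using Cone_mono Sigma_pow_Suc by metis
qed

lemma Sigma_pow_subset: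
  assumes "Cone C S (injectives C) \<subseteq> S"
  shows "Sigma_pow C n S \<subseteq> S"
proof (induction n)
  case 0
  then show ?case by (simp add: Sigma_pow_def)
next
  case (Suc n)
  then show ?case using Sigma_pow_Suc_subset[OF assms, of n] by blast
qed

text \<open>
  Both inclusions shift the dimension along a conflation \<open>A \<rightarrow> W \<rightarrow> X\<close> with \<open>W \<in> U \<inter> V\<close>. If \<open>A\<close> is
  orthogonal to \<open>\<Sigma>\<^sup>nV\<close>, then \<open>X\<close> is orthogonal to \<open>\<Sigma>\<^sup>n\<^sup>+\<^sup>1V\<close>; conversely, the \<open>U\<close>-approximation of an object \<open>X\<close>
  of the right-hand side has this form, and orthogonality descends to \<open>A\<close>.
\<close>

lemma iterated_Cone_core:
  assumes h: "hereditary_cotorsion_pair C U V" and ep: "enough_projectives C"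
    and ei: "enough_injectives C"
  shows "iterated_Cone C (U \<inter> V) n = V \<inter> left_perp C (Sigma_pow C n V)"
proof (induction n)
  case 0
  then show ?case using cotorsion_pair_left[OF hereditary_cotorsion[OF h]]
    by (auto simp: iterated_Cone_def Sigma_pow_def)
next
  case (Suc n)
  note p = hereditary_cotorsion[OF h]
  note \<Sigma>V = hereditary_Cone_injectives[OF h ep]
  have sub: "Sigma_pow C m V \<subseteq> V" for m by (rule Sigma_pow_subset[OF \<Sigma>V])
  have Vo: "V \<subseteq> obj C" using cotorsion_pair_obj[OF p] by blast
  have U: "U \<subseteq> left_perp C (Sigma_pow C m V)" for m
    using sub[of m] cotorsion_pair_left[OF p] by (auto simp: left_perp_def)
  have eq: "iterated_Cone C (U \<inter> V) (Suc n)
      = Cone C (V \<inter> left_perp C (Sigma_pow C n V)) (U \<inter> V)"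
    using Suc by (simp add: iterated_Cone_def)
  show ?case
  proof
    show "iterated_Cone C (U \<inter> V) (Suc n) \<subseteq> V \<inter> left_perp C (Sigma_pow C (Suc n) V)"
    proof
      fix X assume "X \<in> iterated_Cone C (U \<inter> V) (Suc n)"
      then obtain A W x y where A: "A \<in> V" "A \<in> left_perp C (Sigma_pow C n V)" "W \<in> U" "W \<in> V"
        and c: "conflation C A x W y X" unfolding eq by (auto simp: Cone_def)
      obtain \<delta> where d: "etriangle C A x W y X \<delta>" using c unfolding conflation_def by blast
      have "X \<in> V" using hereditary_cone_closed[OF h ep c] A by blast
      moreover have "ext C X Z = {\<zero>\<^bsub>Ext C X Z\<^esub>}" if Z: "Z \<in> Sigma_pow C (Suc n) V" for Z
      proof -
        obtain Z' I u v where Z': "Z' \<in> Sigma_pow C n V" "injective C I" "conflation C Z' u I v Z"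
          using Z unfolding Sigma_pow_Suc by (auto simp: Cone_def)
        obtain \<zeta> where t: "etriangle C Z' u I v Z \<zeta>" using Z'(3) unfolding conflation_def by blast
        note o = etriangleD[OF d] etriangleD[OF t]
        have "\<epsilon> = \<zero>\<^bsub>Ext C X Z\<^esub>" if e: "\<epsilon> \<in> ext C X Z" for \<epsilon>
        proof -
          \<comment> \<open>An extension of \<open>X\<close> by \<open>Z\<close> comes from some \<open>f : A \<rightarrow> Z\<close>, and \<open>f\<close> factors through the injective \<open>I\<close>.\<close>
          have "ext C W Z = {\<zero>\<^bsub>Ext C W Z\<^esub>}" using cotorsion_pair_ext[OF p A(3)] sub Z by blast
          then have "pull C y \<epsilon> = \<zero>\<^bsub>Ext C W Z\<^esub>" using pull_ext[of \<epsilon> X Z y W] o e by auto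
          then obtain f where f: "f \<in> arr C A Z" "push C f \<delta> = \<epsilon>"
            using ext_in_image_of_connecting_push[OF d e] o by blast
          have "pull C f \<zeta> = \<zero>\<^bsub>Ext C A Z'\<^esub>"
            using pull_ext[of \<zeta> Z Z' f A] left_perp_ext[OF A(2) Z'(1)] o f by auto
          then obtain g where g: "g \<in> arr C A I" "v \<cdot>\<^bsub>C\<^esub> g = f"
            using factor_through_deflation[OF t f(1)] o by blast
          have "push C g \<delta> = \<zero>\<^bsub>Ext C X I\<^esub>"
            using push_ext[of \<delta> X A g I] ext_injective[OF Z'(2), of X] o g by auto
          then show ?thesis
            using push_cmp[of X A I Z g v \<delta>] push_zero[of v I Z X] o f g by simp
        qed
        then show ?thesis using ext_trivial_iff o by blast
      qed
      ultimately show "X \<in> V \<inter> left_perp C (Sigma_pow C (Suc n) V)" 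
        using Vo left_perpI[of X "Sigma_pow C (Suc n) V"] by blast
    qed
    show "V \<inter> left_perp C (Sigma_pow C (Suc n) V) \<subseteq> iterated_Cone C (U \<inter> V) (Suc n)"
    proof
      fix X assume X: "X \<in> V \<inter> left_perp C (Sigma_pow C (Suc n) V)"
      then obtain A W x y where A: "A \<in> V" "W \<in> U" and c: "conflation C A x W y X"
        using cotorsion_pair_precover[OF p] Vo by blast
      have W: "W \<in> V" using cotorsion_pair_right_extension[OF p c] A X by blast
      have "ext C A Z = {\<zero>\<^bsub>Ext C A Z\<^esub>}" if Z: "Z \<in> Sigma_pow C n V" for Z
      proof (rule ext_cocone_of_Cone_injectives[OF _ ei c])
        show "Cone C (Sigma_pow C n V) (injectives C) \<subseteq> Sigma_pow C (Suc n) V"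
          by (simp add: Sigma_pow_Suc)
        show "ext C W Z = {\<zero>\<^bsub>Ext C W Z\<^esub>}" using cotorsion_pair_ext[OF p A(2)] sub Z by blast
      qed (use X Z sub Vo in auto)
      then have "A \<in> left_perp C (Sigma_pow C n V)" 
        using A Vo left_perpI[of A "Sigma_pow C n V"] by blast
      then show "X \<in> iterated_Cone C (U \<inter> V) (Suc n)"
        unfolding eq using A W c by (auto simp: Cone_def)
    qed
  qed
qed

end

theorem theorem1p4:
  fixes K :: "'k ring"
    and B :: "('k, 'o, 'm, 'e) ext_cat"
    and U V W :: "'o set"
    and i :: nat
  assumes "extriangulated_category K B"
    and "krull_schmidt B"
    and "hom_finite K B"
    and "enough_projectives B"
    and "enough_injectives B"
    and "condition_WIC B"
    and "hereditary_cotorsion_pair B U V"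
    and "W = U \<inter> V"
    and "i \<ge> 1"
    and "cotorsion_pair B (left_perp B (Sigma_pow B 1 V)) (Sigma_pow B 1 V)"
    and "cotorsion_pair B (left_perp B (Sigma_pow B i V)) (Sigma_pow B i V)"
  shows "\<exists>\<Phi>. bij_betw \<Phi>
    {(U', V'). cotorsion_pair B U' V' \<and> U \<subseteq> U' \<and> U' \<subseteq> left_perp B (Sigma_pow B i V)}
    {(X, Y). cotorsion_pair (full_sub B (iterated_Cone B W i)) X Y}"
proof -
  interpret extriangulated_category K B by fact
  note h = assms(7) and ep = assms(4) and ei = assms(5) and p1 = assms(11)
  let ?V1 = "Sigma_pow B i V" and ?U1 = "left_perp B (Sigma_pow B i V)"
  note \<Sigma>V = hereditary_Cone_injectives[OF h ep]
  have "Cone B ?V1 (injectives B) \<subseteq> ?V1"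
    using Sigma_pow_Suc_subset[OF \<Sigma>V, of i] by (simp add: Sigma_pow_Suc)
  then have h1: "hereditary_cotorsion_pair B ?U1 ?V1" by (rule hereditary_if_Cone_injectives[OF p1 ei])
  interpret cotorsion_interval K B U V ?U1 ?V1
    using ep ei h h1 Sigma_pow_subset[OF \<Sigma>V] by unfold_locales
  have "iterated_Cone B W i = heart"
    using iterated_Cone_core[OF h ep ei] assms(8) by simp
  then show ?thesis using interval_bijection by auto
qed

end
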